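(* Let $f\colon M\rightsquigarrow\mathfrak g$ be a weak Loday-Pirashvili module over a dg Lie algebra $\mathfrak g$. The induced map of tangent cohomology spaces $H_{\mathrm{tan}}(f_0)\colon H_{\mathrm{tan}}^\bullet(M)\to H_{\mathrm{tan}}^\bullet(\mathfrak g)$ is a Loday-Pirashvili module over the graded Lie algebra $H_{\mathrm{tan}}^\bullet(\mathfrak g)$. Moreover, the associated graded Leibniz algebra structure $\diamond$ on $H_{\mathrm{tan}}^\bullet(M)$ can be expressed as follows: for all $d_0^M$-closed homogeneous $u,v\in M$ with cohomology classes $u^\sim,v^\sim$, $$u^\sim\diamond v^\sim=(-1)^{|u|-1}\big(\mathrm{Pr}_M\circ\lambda_2(u[1],v[1])[-1]\big)^\sim,$$ where $\mathrm{Pr}_M\colon C(\mathfrak g,M)\to M$ is the standard projection and $\lambda_2$ is the binary bracket of the Leibniz$_\infty[1]$ $C(\mathfrak g)$-algebra $C(\mathfrak g,M[1])$ associated with $f$.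
   Context: Conventions: $\mathbb K$ is $\mathbb R$ or $\mathbb C$; graded means $\mathbb Z$-graded; dg Lie algebras and (underlying spaces of) $\infty$-modules are finite dimensional; $V[p]^i=V^{i+p}$. For a dg Lie algebra $\mathfrak g=(\mathfrak g,d,[-,-])$, $C(\mathfrak g)=\bigoplus_{p\ge0}C^p(\mathfrak g)$, $C^p(\mathfrak g)=S^p(\mathfrak g^\vee[-1])$, with differential $d_{\mathrm{CE}}=d_0+d_1$, $d_0$ induced by the dual of $d$ and $d_1$ the derivation with $d_1(\xi[-1])(x[1],y[1])=(-1)^{|\xi|+1+|x|}\xi([x,y])$. Put $C^k(\mathfrak g,M)=C^k(\mathfrak g)\otimes M$, $C(\mathfrak g,M)=C(\mathfrak g)\otimes M$. A locally finite $\infty$-$\mathfrak g$-module is a cochain complex $(M,d^M)$ with degree $+1$ maps $d_k^M\colon M\to C^k(\mathfrak g,M)$, $k\ge 0$, $d_0^M=d^M$, such that for each $m$, $d_k^M(m)=0$ for large $k$, and $d_{\mathrm{tot}}^M=d_{\mathrm{CE}}\otimes\mathrm{id}_M+\sum_k\mathrm{id}\otimes d_k^M$ squares to zero on $C(\mathfrak g,M)$. An $\infty$-morphism $f\colon M\rightsquigarrow N$ is a family of degree $0$ maps $f_k\colon M\to C^k(\mathfrak g,N)$, with $f_k(m)=0$ for large $k$ (depending on $m$), whose $C(\mathfrak g)$-linear extension commutes with total differentials; $f(m)=\sum_kf_k(m)$. The adjoint module is $\mathfrak g$ with $d_0^{\mathfrak g}=d$, $\iota_{x[1]}d_1^{\mathfrak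 g}(y)=[x,y]$, $d_k^{\mathfrak g}=0$ for $k\ge2$. A weak Loday-Pirashvili module over $\mathfrak g$ is an $\infty$-morphism $f\colon M\rightsquigarrow\mathfrak g$ to the adjoint module. Tangent cohomology: $H_{\mathrm{tan}}^\bullet(\mathfrak g)=H^\bullet(\mathfrak g,d)$ is a graded Lie algebra with the induced bracket; $H_{\mathrm{tan}}^\bullet(M)=H^\bullet(M,d_0^M)$ is a module over it, with action induced by $x\cdot m=\iota_{x[1]}d_1^M(m)$. A Loday-Pirashvili module over a graded Lie algebra $\mathfrak h$ is a morphism $h\colon V\to\mathfrak h$ of graded $\mathfrak h$-modules from an $\mathfrak h$-module $V$ to the adjoint module; its associated graded (left) Leibniz algebra structure on $V$ is $v_1\diamond v_2=h(v_1)\cdot v_2$. Associated bracket: for $b=\sum_i\omega_i\otimes x_i\in C(\mathfrak g)\otimes\mathfrak g$ set $\iota_{b[1]}(\alpha\otimes m[1])=\sum_i\omega_i\odot(\iota_{x_i[1]}\alpha)\otimes m[1]$, where $\iota_{x[1]}\colon C^\bullet(\mathfrak g)\to C^{\bullet-1}(\mathfrak g)$ is contraction, of degree $|x|-1$. The Leibniz$_\infty[1]$ $C(\mathfrak g)$-algebra structure associated with $f$ has unary bracket $d_{\mathrm{tot}}^{M[1]}$ and binary bracket $\lambda_2$ the $C(\mathfrak g)$-bilinear extension of $\lambda_2(m_1[1],m_2[1])=(-1)^{|m_1|-1}\iota_{f(m_1)[1]}\big(\sum_{k\ge1}d_k^Mm_2\big)[1]$. The shift $[-1]$ in the claim turns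 elements of $C(\mathfrak g,M[1])$ into elements of $C(\mathfrak g,M)$. *)

theory Defs
  imports Complex_Main
begin

text \<open>
  The ground field is a type \<open>'k::real_normed_field\<close>. By the Gelfand-Mazur theorem such a field
  is isomorphic to the real or to the complex numbers, so this class expresses that the ground
  field is one of these two.
\<close>

section \<open>Graded algebra on carriers\<close>

text \<open>
  A graded vector space given by carrier sets. This form is used for cohomology, whose elements are
  cosets. All axioms concern homogeneous elements only.
\<close>

record ('k, 'v) gvec =
  gcomp :: "int \<Rightarrow> 'v set"
  gadd :: "'v \<Rightarrow> 'v \<Rightarrow> 'v"
  gzero :: "'v"
  gsmult :: "'k \<Rightarrow> 'v \<Rightarrow> 'v"

definition graded_vector_space :: "('k::field, 'v) gvec \<Rightarrow> bool" where
  "graded_vector_space V \<longleftrightarrow> (\<forall>i.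
     gzero V \<in> gcomp V i \<and>
     (\<forall>x\<in>gcomp V i. \<forall>y\<in>gcomp V i. gadd V x y \<in> gcomp V i \<and> gadd V x y = gadd V y x) \<and>
     (\<forall>x\<in>gcomp V i. \<forall>y\<in>gcomp V i. \<forall>z\<in>gcomp V i.
        gadd V (gadd V x y) z = gadd V x (gadd V y z)) \<and>
     (\<forall>x\<in>gcomp V i. gadd V (gzero V) x = x \<and> gsmult V 1 x = x \<and>
        (\<exists>y\<in>gcomp V i. gadd V x y = gzero V)) \<and>
     (\<forall>c. \<forall>x\<in>gcomp V i. gsmult V c x \<in> gcomp V i) \<and>
     (\<forall>c e. \<forall>x\<in>gcomp V i. gsmult V (c * e) x = gsmult V c (gsmult V e x) \<and>
        gsmult V (c + e) x = gadd V (gsmult V c x) (gsmult V e x)) \<and>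
     (\<forall>c. \<forall>x\<in>gcomp V i. \<forall>y\<in>gcomp V i.
        gsmult V c (gadd V x y) = gadd V (gsmult V c x) (gsmult V c y)))"

definition graded_linear ::
  "('k, 'v) gvec \<Rightarrow> ('k, 'w) gvec \<Rightarrow> ('v \<Rightarrow> 'w) \<Rightarrow> bool" where
  "graded_linear V W h \<longleftrightarrow> (\<forall>i.
     (\<forall>x\<in>gcomp V i. h x \<in> gcomp W i) \<and>
     (\<forall>x\<in>gcomp V i. \<forall>y\<in>gcomp V i. h (gadd V x y) = gadd W (h x) (h y)) \<and>
     (\<forall>c. \<forall>x\<in>gcomp V i. h (gsmult V c x) = gsmult W c (h x)))"

definition graded_bilinear ::
  "('k, 'u) gvec \<Rightarrow> ('k, 'v) gvec \<Rightarrow> ('k, 'w) gvec \<Rightarrow> ('u \<Rightarrow> 'v \<Rightarrow> 'w) \<Rightarrow> bool" where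
  "graded_bilinear U V W m \<longleftrightarrow> (\<forall>i j.
     (\<forall>x\<in>gcomp U i. \<forall>y\<in>gcomp V j. m x y \<in> gcomp W (i + j)) \<and>
     (\<forall>x\<in>gcomp U i. \<forall>x'\<in>gcomp U i. \<forall>y\<in>gcomp V j.
        m (gadd U x x') y = gadd W (m x y) (m x' y)) \<and>
     (\<forall>x\<in>gcomp U i. \<forall>y\<in>gcomp V j. \<forall>y'\<in>gcomp V j.
        m x (gadd V y y') = gadd W (m x y) (m x y')) \<and>
     (\<forall>c. \<forall>x\<in>gcomp U i. \<forall>y\<in>gcomp V j.
        m (gsmult U c x) y = gsmult W c (m x y) \<and> m x (gsmult V c y) = gsmult W c (m x y)))"

definition graded_Lie_algebra ::
  "('k::field, 'v) gvec \<Rightarrow> ('v \<Rightarrow> 'v \<Rightarrow> 'v) \<Rightarrow> bool" where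
  "graded_Lie_algebra V br \<longleftrightarrow>
     graded_vector_space V \<and> graded_bilinear V V V br \<and>
     (\<forall>i j. \<forall>x\<in>gcomp V i. \<forall>y\<in>gcomp V j.
        br x y = gsmult V (- ((-1) powi (i * j))) (br y x)) \<and>
     (\<forall>i j k. \<forall>x\<in>gcomp V i. \<forall>y\<in>gcomp V j. \<forall>z\<in>gcomp V k.
        br x (br y z) = gadd V (br (br x y) z) (gsmult V ((-1) powi (i * j)) (br y (br x z))))"

definition graded_Lie_module ::
  "('k::field, 'h) gvec \<Rightarrow> ('h \<Rightarrow> 'h \<Rightarrow> 'h) \<Rightarrow> ('k, 'v) gvec \<Rightarrow> ('h \<Rightarrow> 'v \<Rightarrow> 'v) \<Rightarrow> bool" where
  "graded_Lie_module H br V act \<longleftrightarrow>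
     graded_vector_space V \<and> graded_bilinear H V V act \<and>
     (\<forall>i j k. \<forall>x\<in>gcomp H i. \<forall>y\<in>gcomp H j. \<forall>v\<in>gcomp V k.
        act (br x y) v =
          gadd V (act x (act y v)) (gsmult V (- ((-1) powi (i * j))) (act y (act x v))))"

definition Loday_Pirashvili_module ::
  "('k::field, 'h) gvec \<Rightarrow> ('h \<Rightarrow> 'h \<Rightarrow> 'h) \<Rightarrow> ('k, 'v) gvec \<Rightarrow> ('h \<Rightarrow> 'v \<Rightarrow> 'v) \<Rightarrow> ('v \<Rightarrow> 'h) \<Rightarrow> bool"
  where
  "Loday_Pirashvili_module H br V act h \<longleftrightarrow>
     graded_Lie_algebra H br \<and> graded_Lie_module H br V act \<and> graded_linear V H h \<and>
     (\<forall>i j. \<forall>x\<in>gcomp H i. \<forall>v\<in>gcomp V j. h (act x v) = br x (h v))"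

definition LP_Leibniz :: "('h \<Rightarrow> 'v \<Rightarrow> 'v) \<Rightarrow> ('v \<Rightarrow> 'h) \<Rightarrow> 'v \<Rightarrow> 'v \<Rightarrow> 'v" where
  "LP_Leibniz act h v w = act (h v) w"

lemma LP_Leibniz_identity:
  assumes "Loday_Pirashvili_module H br V act h"
    and "u \<in> gcomp V i" "v \<in> gcomp V j" "w \<in> gcomp V k"
  shows "LP_Leibniz act h u (LP_Leibniz act h v w) =
    gadd V (LP_Leibniz act h (LP_Leibniz act h u v) w)
      (gsmult V ((-1) powi (i * j)) (LP_Leibniz act h v (LP_Leibniz act h u w)))"
proof -
  have gv: "graded_vector_space V" and bil: "graded_bilinear H V V act"
    and gl: "graded_linear V H h"
    and md: "\<forall>i j k. \<forall>x\<in>gcomp H i. \<forall>y\<in>gcomp H j. \<forall>v\<in>gcomp V k.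
        act (br x y) v =
          gadd V (act x (act y v)) (gsmult V (- ((-1) powi (i * j))) (act y (act x v)))"
    and mor: "\<forall>i j. \<forall>x\<in>gcomp H i. \<forall>v\<in>gcomp V j. h (act x v) = br x (h v)"
    using assms(1) unfolding Loday_Pirashvili_module_def graded_Lie_module_def by blast+
  have hu: "h u \<in> gcomp H i" and hv: "h v \<in> gcomp H j"
    using gl assms unfolding graded_linear_def by blast+
  define a where "a = act (h u) (act (h v) w)"
  define b where "b = act (h v) (act (h u) w)"
  define s :: 'a where "s = (-1) powi (i * j)"
  have cl: "\<And>x y i j. x \<in> gcomp H i \<Longrightarrow> y \<in> gcomp V j \<Longrightarrow> act x y \<in> gcomp V (i + j)"
    using bil unfolding graded_bilinear_def by blast
  have a: "a \<in> gcomp V (i + (j + k))" unfolding a_def using cl hu hv assms by blast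
  have b: "b \<in> gcomp V (i + (j + k))" unfolding b_def using cl[OF hv cl[OF hu assms(4)]]
    by (simp add: algebra_simps)
  let ?n = "i + (j + k)"
  have sm: "\<And>c x. x \<in> gcomp V ?n \<Longrightarrow> gsmult V c x \<in> gcomp V ?n"
    and dist: "\<And>c e x. x \<in> gcomp V ?n \<Longrightarrow> gsmult V (c + e) x = gadd V (gsmult V c x) (gsmult V e x)"
    and assoc: "\<And>x y z. x \<in> gcomp V ?n \<Longrightarrow> y \<in> gcomp V ?n \<Longrightarrow> z \<in> gcomp V ?n \<Longrightarrow>
        gadd V (gadd V x y) z = gadd V x (gadd V y z)"
    and comm: "\<And>x y. x \<in> gcomp V ?n \<Longrightarrow> y \<in> gcomp V ?n \<Longrightarrow> gadd V x y = gadd V y x"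
    and zero: "\<And>x. x \<in> gcomp V ?n \<Longrightarrow> gadd V (gzero V) x = x" "gzero V \<in> gcomp V ?n"
    and inv: "\<And>x. x \<in> gcomp V ?n \<Longrightarrow> \<exists>y\<in>gcomp V ?n. gadd V x y = gzero V"
    and add: "\<And>x y. x \<in> gcomp V ?n \<Longrightarrow> y \<in> gcomp V ?n \<Longrightarrow> gadd V x y \<in> gcomp V ?n"
    using gv unfolding graded_vector_space_def by blast+
  have z: "gsmult V 0 b = gzero V"
  proof -
    have "gadd V (gsmult V 0 b) (gsmult V 0 b) = gsmult V 0 b"
      using dist[OF b, of 0 0] by simp
    then show ?thesis using inv[OF sm[OF b, of 0]] assoc comm zero sm[OF b, of 0] by metis
  qed
  have "act (br (h u) (h v)) w = gadd V a (gsmult V (- s) b)"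
    using md hu hv assms(4) unfolding a_def b_def s_def by blast
  then have "gadd V (act (br (h u) (h v)) w) (gsmult V s b) = gadd V a (gsmult V (- s + s) b)"
    using assoc[OF a sm[OF b] sm[OF b]] dist[OF b, of "- s" s] by simp
  also have "\<dots> = a" using z zero comm[OF a] a by simp
  finally show ?thesis
    using mor hu assms(3) unfolding LP_Leibniz_def a_def b_def s_def by metis
qed

section \<open>Finite-dimensional graded vector spaces and dg Lie algebras\<close>

record ('k, 'v) gspace =
  scl :: "'k \<Rightarrow> 'v \<Rightarrow> 'v"
  hom :: "int \<Rightarrow> 'v set"

definition as_gvec :: "('k, 'v::ab_group_add, 'x) gspace_scheme \<Rightarrow> ('k, 'v) gvec" where
  "as_gvec V = \<lparr>gcomp = hom V, gadd = (+), gzero = 0, gsmult = scl V\<rparr>"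

definition decomposition ::
  "('k, 'v::ab_group_add, 'x) gspace_scheme \<Rightarrow> 'v \<Rightarrow> (int \<Rightarrow> 'v) \<Rightarrow> bool" where
  "decomposition V v c \<longleftrightarrow>
     (\<forall>i. c i \<in> hom V i) \<and> finite {i. c i \<noteq> 0} \<and> v = (\<Sum>i | c i \<noteq> 0. c i)"

definition fd_graded_space :: "('k::field, 'v::ab_group_add, 'x) gspace_scheme \<Rightarrow> bool" where
  "fd_graded_space V \<longleftrightarrow>
     vector_space (scl V) \<and>
     (\<exists>B. finite B \<and> module.span (scl V) B = UNIV) \<and>
     (\<forall>i. module.subspace (scl V) (hom V i)) \<and>
     (\<forall>v. \<exists>!c. decomposition V v c)"

definition component :: "('k, 'v::ab_group_add, 'x) gspace_scheme \<Rightarrow> int \<Rightarrow> 'v \<Rightarrow> 'v" where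
  "component V i v = (THE c. decomposition V v c) i"

lemma component_decomposition:
  assumes "fd_graded_space V" shows "decomposition V v (\<lambda>i. component V i v)"
  using assms theI'[of "decomposition V v"] unfolding fd_graded_space_def component_def by simp

lemma component_eqI:
  assumes "fd_graded_space V" "decomposition V v c" shows "component V i v = c i"
  using assms component_decomposition[OF assms(1), of v] unfolding fd_graded_space_def by metis

lemma component_homogeneous:
  assumes V: "fd_graded_space V" and v: "v \<in> hom V i"
  shows "component V j v = (if j = i then v else 0)"
proof (rule component_eqI[OF V])
  have ms: "module (scl V)" 
    using V unfolding fd_graded_space_def vector_space_def module_def by simp
  have "0 \<in> hom V j" for j
    using V module.subspace_0[OF ms] unfolding fd_graded_space_def by blast
  moreover have "{j. (if j = i then v else 0) \<noteq> 0} = (if v = 0 then {} else {i})" by auto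
  ultimately show "decomposition V v (\<lambda>j. if j = i then v else 0)"
    using v unfolding decomposition_def by auto
qed

record ('k, 'g) dgla = "('k, 'g) gspace" +
  dif :: "'g \<Rightarrow> 'g"
  brk :: "'g \<Rightarrow> 'g \<Rightarrow> 'g"

text \<open>\<open>sgnpow n v\<close> is \<open>(-1)\<^sup>n v\<close>.\<close>

definition sgnpow :: "int \<Rightarrow> 'v::ab_group_add \<Rightarrow> 'v" where
  "sgnpow n v = (if even n then v else - v)"

definition dg_Lie_algebra :: "('k::field, 'g::ab_group_add) dgla \<Rightarrow> bool" where
  "dg_Lie_algebra g \<longleftrightarrow>
     fd_graded_space g \<and>
     (\<forall>x. Vector_Spaces.linear (scl g) (scl g) (brk g x)) \<and>
     (\<forall>y. Vector_Spaces.linear (scl g) (scl g) (\<lambda>x. brk g x y)) \<and>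
     graded_Lie_algebra (as_gvec g) (brk g) \<and>
     Vector_Spaces.linear (scl g) (scl g) (dif g) \<and>
     (\<forall>i. \<forall>x\<in>hom g i. dif g x \<in> hom g (i + 1)) \<and>
     (\<forall>x. dif g (dif g x) = 0) \<and>
     (\<forall>i. \<forall>x\<in>hom g i. \<forall>y.
        dif g (brk g x y) = brk g (dif g x) y + sgnpow i (brk g x (dif g y)))"

section \<open>Cochains\<close>

text \<open>
  As \<open>g\<close> is finite dimensional and the characteristic is 0, \<open>S\<^sup>p(g\<^sup>\<or>[-1]) \<otimes> W\<close> is the space of
  graded symmetric \<open>p\<close>-linear maps from \<open>g[1]\<close> to \<open>W\<close>. An element of \<open>C(g, W)\<close> is therefore a
  function on lists over \<open>g\<close>, the list \<open>[x\<^sub>1, \<dots>, x\<^sub>p]\<close> standing for the arguments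
  \<open>x\<^sub>1[1], \<dots>, x\<^sub>p[1]\<close>; its part in \<open>C\<^sup>p(g, W)\<close> is the restriction to lists of length \<open>p\<close>.
  Multiplication, evaluation and contraction follow the Koszul rule:
  \<open>(\<omega> \<otimes> w)(x\<^sub>1[1], \<dots>) = \<omega>(x\<^sub>1[1], \<dots>) w\<close> for a form \<open>\<omega>\<close> and \<open>w \<in> W\<close> (no sign),
  \<open>(\<xi>[-1] \<odot> \<eta>[-1])(x[1], y[1])\<close> contains the term \<open>(-1)\<^bsup>|\<eta>[-1]| |x[1]|\<^esup> \<xi>(x) \<eta>(y)\<close>, and
  contraction, a left derivation, is \<open>\<iota>\<^bsub>x[1]\<^esub>\<omega> = (-1)\<^bsup>|x[1]| |\<omega>|\<^esup> \<omega>(x[1], \<dots>)\<close>.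
  A form \<open>\<omega>\<close> takes values in the ground field, so its degree, wherever \<open>\<omega>(x\<^sub>1[1], \<dots>, x\<^sub>p[1])\<close>
  does not vanish, is \<open>-(|x\<^sub>1[1]| + \<dots> + |x\<^sub>p[1]|)\<close>; this is how degrees of forms enter below.
\<close>

text \<open>
  \<open>hom_ext\<close> extends a formula given on homogeneous arguments, tagged by their degrees in \<open>g\<close>,
  to arbitrary arguments.
\<close>

fun hom_ext ::
  "('k, 'g::ab_group_add, 'x) gspace_scheme \<Rightarrow> ((int \<times> 'g) list \<Rightarrow> 'w::ab_group_add) \<Rightarrow> 'g list \<Rightarrow> 'w"
  where
  "hom_ext g F [] = F []"
| "hom_ext g F (x # xs) = (\<Sum>i | component g i x \<noteq> 0. hom_ext g (\<lambda>ts. F ((i, component g i x) # ts)) xs)"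

text \<open>The total degree of \<open>x\<^sub>1[1], \<dots>, x\<^sub>p[1]\<close>.\<close>

definition sdeg :: "(int \<times> 'g) list \<Rightarrow> int" where
  "sdeg ts = (\<Sum>t\<leftarrow>ts. fst t - 1)"

text \<open>
  The exponent of the Koszul sign for reordering \<open>x\<^sub>1[1], \<dots>, x\<^sub>p[1]\<close> so that the arguments with
  positions in \<open>S\<close> come first, the order within \<open>S\<close> and within its complement being kept.
\<close>

definition koszul :: "(int \<times> 'g) list \<Rightarrow> nat set \<Rightarrow> int" where
  "koszul ts S = (\<Sum>(p, q) \<in> {(p, q). p < q \<and> q < length ts \<and> p \<notin> S \<and> q \<in> S}.
     (fst (ts ! p) - 1) * (fst (ts ! q) - 1))"

definition cochains ::
  "('k::field, 'g::ab_group_add, 'x) gspace_scheme \<Rightarrow> ('k, 'w::ab_group_add, 'y) gspace_scheme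
   \<Rightarrow> ('g list \<Rightarrow> 'w) set" where
  "cochains g W = {\<mu>.
     (\<forall>as bs. Vector_Spaces.linear (scl g) (scl W) (\<lambda>x. \<mu> (as @ x # bs))) \<and>
     (\<forall>as bs i j. \<forall>x\<in>hom g i. \<forall>y\<in>hom g j.
        \<mu> (as @ y # x # bs) = sgnpow ((i - 1) * (j - 1)) (\<mu> (as @ x # y # bs))) \<and>
     (\<exists>n. \<forall>xs. length xs > n \<longrightarrow> \<mu> xs = 0)}"

definition cochains_of_length ::
  "nat \<Rightarrow> ('k::field, 'g::ab_group_add, 'x) gspace_scheme \<Rightarrow> ('k, 'w::ab_group_add, 'y) gspace_scheme
   \<Rightarrow> ('g list \<Rightarrow> 'w) set" where
  "cochains_of_length k g W = {\<mu> \<in> cochains g W. \<forall>xs. length xs \<noteq> k \<longrightarrow> \<mu> xs = 0}"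

definition has_total_degree ::
  "('k, 'g, 'x) gspace_scheme \<Rightarrow> ('k, 'w, 'y) gspace_scheme \<Rightarrow> int \<Rightarrow> ('g list \<Rightarrow> 'w) \<Rightarrow> bool" where
  "has_total_degree g W n \<mu> \<longleftrightarrow>
     (\<forall>ts. (\<forall>(i, x) \<in> set ts. x \<in> hom g i) \<longrightarrow> \<mu> (map snd ts) \<in> hom W (n + sdeg ts))"

text \<open>The inclusion of \<open>W\<close> as \<open>C\<^sup>0(g, W)\<close>, and the projection of \<open>C(g, W)\<close> onto it.\<close>

definition incl0 :: "'w::zero \<Rightarrow> 'g list \<Rightarrow> 'w" where
  "incl0 w xs = (if xs = [] then w else 0)"

definition Pr :: "('g list \<Rightarrow> 'w) \<Rightarrow> 'w" where
  "Pr \<mu> = \<mu> []"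

lemma hom_ext_homogeneous:
  assumes "fd_graded_space V" "v \<in> hom V i"
  shows "hom_ext V F (v # vs) = (if v = 0 then 0 else hom_ext V (\<lambda>ts. F ((i, v) # ts)) vs)"
proof -
  have "{j. component V j v \<noteq> 0} = (if v = 0 then {} else {i})"
    using component_homogeneous[OF assms] by auto
  then show ?thesis using component_homogeneous[OF assms] by simp
qed

lemma sgnpow_0 [simp]: "sgnpow n 0 = 0" by (simp add: sgnpow_def)
lemma sgnpow_sgnpow [simp]: "sgnpow m (sgnpow n v) = sgnpow (m + n) v" by (auto simp add: sgnpow_def)

lemma sdeg_simps [simp]: "sdeg [] = 0" "sdeg (t # ts) = (fst t - 1) + sdeg ts"
  by (simp_all add: sdeg_def)

lemma sdeg_nths: "sdeg (nths ts S) = (\<Sum>q | q < length ts \<and> q \<in> S. fst (ts ! q) - 1)"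
proof (induction ts arbitrary: S)
  case (Cons t ts)
  have "{q. q < length (t # ts) \<and> q \<in> S} =
     (if 0 \<in> S then {0} else {}) \<union> Suc ` {q. q < length ts \<and> q \<in> {j. Suc j \<in> S}}"
    (is "?L = ?R")
  proof (rule set_eqI)
    fix q show "q \<in> ?L \<longleftrightarrow> q \<in> ?R" by (cases q) auto
  qed
  moreover have "(\<Sum>q \<in> Suc ` {q. q < length ts \<and> q \<in> {j. Suc j \<in> S}}. fst ((t # ts) ! q) - 1) =
     sdeg (nths ts {j. Suc j \<in> S})"
    by (subst sum.reindex) (auto simp: Cons.IH)
  ultimately show ?case by (auto simp: nths_Cons sum.insert image_iff)
qed simp

lemma koszul_Nil [simp]: "koszul [] S = 0" by (simp add: koszul_def)

lemma koszul_Cons: "koszul (t # ts) S =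
   (if 0 \<in> S then 0 else (fst t - 1) * sdeg (nths ts {j. Suc j \<in> S})) + koszul ts {j. Suc j \<in> S}"
proof -
  let ?S = "{j. Suc j \<in> S}"
  let ?P = "\<lambda>ts S. {(p, q). p < q \<and> q < length ts \<and> p \<notin> S \<and> q \<in> S}"
  let ?Q = "{q. q < length ts \<and> q \<in> ?S}"
  let ?h = "\<lambda>(p, q). (fst ((t # ts) ! p) - 1) * (fst ((t # ts) ! q) - 1)"
  have fin: "finite (?P us T)" for us :: "(int \<times> 'a) list" and T
    by (rule finite_subset[of _ "{..<length us} \<times> {..<length us}"]) auto
  have "?P (t # ts) S = (if 0 \<in> S then {} else Pair 0 ` Suc ` ?Q) \<union> map_prod Suc Suc ` ?P ts ?S"
    (is "?L = ?R")
  proof (rule set_eqI, clarify)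
    fix p q show "(p, q) \<in> ?L \<longleftrightarrow> (p, q) \<in> ?R" by (cases p; cases q) (auto simp: image_iff)
  qed
  moreover have "(\<Sum>x \<in> Pair 0 ` Suc ` ?Q. ?h x) = (fst t - 1) * sdeg (nths ts ?S)"
    unfolding sdeg_nths by (subst sum.reindex, force simp: inj_on_def)+ (simp add: sum_distrib_left)
  moreover have "(\<Sum>x \<in> map_prod Suc Suc ` ?P ts ?S. ?h x) = koszul ts ?S"
    unfolding koszul_def by (subst sum.reindex) (auto simp: inj_on_def intro!: sum.cong)
  moreover have "sum ?h ((if 0 \<in> S then {} else Pair 0 ` Suc ` ?Q) \<union> map_prod Suc Suc ` ?P ts ?S)
     = sum ?h (if 0 \<in> S then {} else Pair 0 ` Suc ` ?Q) + sum ?h (map_prod Suc Suc ` ?P ts ?S)"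
    by (rule sum.union_disjoint) (auto intro!: finite_imageI fin simp del: mem_Collect_eq)
  ultimately show ?thesis unfolding koszul_def[of "t # ts"] by auto
qed

lemma sum_Pow_Suc:
  "(\<Sum>S\<in>Pow {..<Suc n}. G S) = (\<Sum>S\<in>Pow {..<n}. G (Suc ` S) + G (insert 0 (Suc ` S)))"
proof -
  have 1: "Pow {..<Suc n} = (\<lambda>S. Suc ` S) ` Pow {..<n} \<union> (\<lambda>S. insert 0 (Suc ` S)) ` Pow {..<n}"
    by (simp add: lessThan_Suc_eq_insert_0 Pow_insert image_Pow_surj image_image[symmetric])
  have "inj_on (\<lambda>S. Suc ` S) X" for X by (auto simp: inj_on_def)
  moreover have "inj_on (\<lambda>S. insert 0 (Suc ` S)) X" for X
    by (rule inj_onI) (metis Suc_inject image_iff insert_ident inj_image_eq_iff inj_Suc nat.distinct(1))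
  ultimately show ?thesis
    unfolding 1 by (subst sum.union_disjoint) (auto simp: sum.reindex sum.distrib)
qed

lemma Suc_vimage [simp]:
  "{j. Suc j \<in> Suc ` S} = S" "{j. Suc j \<notin> Suc ` S} = - S"
  "{j. Suc j \<in> insert 0 (Suc ` S)} = S" "{j. Suc j \<notin> insert 0 (Suc ` S)} = - S"
  by auto

lemma split_simps:
  "nths (t # ts) (Suc ` S) = nths ts S"
  "nths (t # ts) (- (Suc ` S)) = t # nths ts (- S)"
  "nths (t # ts) (insert 0 (Suc ` S)) = t # nths ts S"
  "nths (t # ts) (- insert 0 (Suc ` S)) = nths ts (- S)"
  "koszul (t # ts) (Suc ` S) = (fst t - 1) * sdeg (nths ts S) + koszul ts S"
  "koszul (t # ts) (insert 0 (Suc ` S)) = koszul ts S"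
  by (simp_all add: nths_Cons koszul_Cons image_iff flip: Compl_eq)

text \<open>Lists of nonzero homogeneous elements tagged by their degrees.\<close>

definition tagged where
  "tagged V ts \<longleftrightarrow> (\<forall>(i, x) \<in> set ts. x \<in> hom V i \<and> x \<noteq> 0)"

lemma hom_ext_tagged:
  assumes V: "fd_graded_space V" and "tagged V ts"
  shows "hom_ext V F (map snd ts) = F ts"
  using assms(2)
proof (induction ts arbitrary: F)
  case (Cons t ts)
  obtain i x where t: "t = (i, x)" by force
  with Cons.prems have "x \<in> hom V i" "x \<noteq> 0" "tagged V ts" by (auto simp: tagged_def)
  then show ?case by (simp add: t hom_ext_homogeneous[OF V] Cons.IH del: hom_ext.simps)
qed simp

lemma hom_ext_cong:
  assumes V: "fd_graded_space V" and "\<And>ts. tagged V ts \<Longrightarrow> length ts = length vs \<Longrightarrow> F ts = F' ts"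
  shows "hom_ext V F vs = hom_ext V F' vs"
  using assms(2)
proof (induction vs arbitrary: F F')
  case Nil then show ?case by (simp add: tagged_def)
next
  case (Cons v vs)
  have "hom_ext V (\<lambda>ts. F ((i, component V i v) # ts)) vs = hom_ext V (\<lambda>ts. F' ((i, component V i v) # ts)) vs"
    if "component V i v \<noteq> 0" for i
  proof (rule Cons.IH)
    fix ts assume "tagged V ts" "length ts = length vs"
    moreover have "component V i v \<in> hom V i"
      using component_decomposition[OF V] by (simp add: decomposition_def)
    ultimately show "F ((i, component V i v) # ts) = F' ((i, component V i v) # ts)"
      using that by (intro Cons.prems) (auto simp: tagged_def)
  qed
  then show ?case by (auto intro: sum.cong)
qed

lemma hom_ext_add: "hom_ext V (\<lambda>ts. F ts + F' ts) vs = hom_ext V F vs + hom_ext V F' vs"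
  by (induction vs arbitrary: F F') (simp_all add: sum.distrib)

lemma hom_ext_sgnpow: "hom_ext V (\<lambda>ts. sgnpow n (F ts)) vs = sgnpow n (hom_ext V F vs)"
proof (induction vs arbitrary: F)
  case (Cons v vs) then show ?case by (simp add: sgnpow_def sum_negf)
qed simp

lemma sgnpow_sum: "sgnpow n (sum F A) = (\<Sum>a\<in>A. sgnpow n (F a))"
  by (simp add: sgnpow_def sum_negf)

lemma sgnpow_even: "even (m - n) \<Longrightarrow> sgnpow m v = sgnpow n v"
  by (auto simp: sgnpow_def)

lemma tagged_nths: "tagged V ts \<Longrightarrow> tagged V (nths ts S)"
  using set_nths_subset unfolding tagged_def by fastforce

lemma tagged_Cons: "tagged V ((i, x) # ts) \<longleftrightarrow> x \<in> hom V i \<and> x \<noteq> 0 \<and> tagged V ts"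
  by (auto simp: tagged_def)


lemma hom_ext_zero: "hom_ext V (\<lambda>ts. 0) vs = 0"
  by (induction vs) simp_all

lemma sdeg_split: "sdeg (nths ts S) + sdeg (nths ts (- S)) = sdeg ts"
proof (induction ts arbitrary: S)
  case (Cons t ts)
  then show ?case using Cons[of "{j. Suc j \<in> S}"] 
    by (simp add: nths_Cons Collect_neg_eq)
qed simp

text \<open>
  \<open>cl_ext g p T\<close> is the \<open>C(g)\<close>-linear extension of a map \<open>T\<close> of degree \<open>p\<close> with values in
  \<open>C(g, W)\<close>: it sends \<open>\<omega> \<otimes> v\<close> to \<open>(-1)\<^bsup>p |\<omega>|\<^esup> \<omega> \<odot> T v\<close>
  (\<open>cl_ext_tensor\<close>). The summand for \<open>S\<close> is the one in which
  \<open>\<omega>\<close> receives the arguments with positions in \<open>S\<close>. Its sign is made up of the Koszul sign of the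
  reordering, of the sign \<open>(-1)\<^bsup>|\<alpha>| |x\<^sub>S|\<^esup>\<close> for moving the form part \<open>\<alpha>\<close> of \<open>T v\<close> past the arguments
  of \<open>\<omega>\<close>, and of \<open>(-1)\<^bsup>p |\<omega>|\<^esup>\<close>.
\<close>

definition cl_ext ::
  "('k, 'g::ab_group_add, 'x) gspace_scheme \<Rightarrow> int \<Rightarrow> ('v \<Rightarrow> 'g list \<Rightarrow> 'w::ab_group_add)
   \<Rightarrow> ('g list \<Rightarrow> 'v) \<Rightarrow> 'g list \<Rightarrow> 'w" where
  "cl_ext g p T \<beta> = hom_ext g (\<lambda>ts. \<Sum>S \<in> Pow {..<length ts}.
     sgnpow (koszul ts S + sdeg (nths ts (- S)) * sdeg (nths ts S) + p * sdeg (nths ts S))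
       (T (\<beta> (map snd (nths ts S))) (map snd (nths ts (- S)))))"

definition odot ::
  "('k, 'g::ab_group_add, 'x) gspace_scheme \<Rightarrow> ('k, 'w::ab_group_add, 'y) gspace_scheme
   \<Rightarrow> ('g list \<Rightarrow> 'k) \<Rightarrow> ('g list \<Rightarrow> 'w) \<Rightarrow> 'g list \<Rightarrow> 'w" where
  "odot g W \<omega> \<mu> = cl_ext g 0 (\<lambda>c ys. scl W c (\<mu> ys)) \<omega>"

lemma cl_ext_tensor:
  assumes g: "fd_graded_space g" and W: "vector_space (scl W)"
    and T: "\<And>c ys. T (scl V c v) ys = scl W c (T v ys)"
    and deg: "\<And>ts. tagged g ts \<Longrightarrow> \<omega> (map snd ts) \<noteq> 0 \<Longrightarrow> sdeg ts = - n"
  shows "cl_ext g p T (\<lambda>xs. scl V (\<omega> xs) v) xs = sgnpow (p * n) (odot g W \<omega> (T v) xs)"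
proof -
  have ms: "module (scl W)" using W unfolding vector_space_def module_def by simp
  show ?thesis
    unfolding cl_ext_def odot_def hom_ext_sgnpow[symmetric]
  proof (rule hom_ext_cong[OF g])
    fix ts :: "(int \<times> 'b) list" assume ts: "tagged g ts"
    have "sgnpow (a + p * sdeg (nths ts S)) (scl W (\<omega> (map snd (nths ts S))) z)
        = sgnpow (p * n) (sgnpow (a + 0 * sdeg (nths ts S)) (scl W (\<omega> (map snd (nths ts S))) z))" for a S z
      using deg[OF tagged_nths[OF ts], of S] module.scale_zero_left[OF ms]
      by (cases "\<omega> (map snd (nths ts S)) = 0") (auto simp: sgnpow_def)
    then show "(\<Sum>S\<in>Pow {..<length ts}.
         sgnpow (koszul ts S + sdeg (nths ts (- S)) * sdeg (nths ts S) + p * sdeg (nths ts S))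
          (T (scl V (\<omega> (map snd (nths ts S))) v) (map snd (nths ts (- S))))) =
       sgnpow (p * n) (\<Sum>S\<in>Pow {..<length ts}.
         sgnpow (koszul ts S + sdeg (nths ts (- S)) * sdeg (nths ts S) + 0 * sdeg (nths ts S))
          (scl W (\<omega> (map snd (nths ts S))) (T v (map snd (nths ts (- S))))))"
      unfolding sgnpow_sum T by (intro sum.cong refl)
  qed
qed

definition contract ::
  "('k, 'g::ab_group_add, 'x) gspace_scheme \<Rightarrow> 'g \<Rightarrow> ('g list \<Rightarrow> 'w::ab_group_add) \<Rightarrow> 'g list \<Rightarrow> 'w"
  where
  "contract g x \<mu> ys =
     hom_ext g (\<lambda>ts. sgnpow ((fst (hd ts) - 1) * sdeg ts) (\<mu> (map snd ts))) (x # ys)"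

lemma contract_homogeneous:
  assumes g: "fd_graded_space g" and x: "x \<in> hom g i"
  shows "contract g x \<mu> zs = (if x = 0 then 0 else
    hom_ext g (\<lambda>ts. sgnpow ((i - 1) * (i - 1 + sdeg ts)) (\<mu> (x # map snd ts))) zs)"
  unfolding contract_def by (simp add: hom_ext_homogeneous[OF g x] del: hom_ext.simps)

lemma contract_tagged:
  assumes g: "fd_graded_space g" and x: "x \<in> hom g i" and ts: "tagged g ts"
  shows "contract g x \<mu> (map snd ts) = (if x = 0 then 0 else
     sgnpow ((i - 1) * (i - 1 + sdeg ts)) (\<mu> (x # map snd ts)))"
  unfolding contract_homogeneous[OF g x] hom_ext_tagged[OF g ts] by simp

text \<open>For a form \<open>\<omega>\<close> homogeneous of degree \<open>n\<close> and \<open>x\<close> homogeneous of degree \<open>i\<close>.\<close>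

lemma contract_odot:
  fixes g :: "('k::field, 'g::ab_group_add, 'x) gspace_scheme"
    and W :: "('k, 'w::ab_group_add, 'y) gspace_scheme"
  assumes g: "fd_graded_space g" and x: "x \<in> hom g i" and W: "vector_space (scl W)"
    and deg: "\<And>ts. tagged g ts \<Longrightarrow> \<omega> (map snd ts) \<noteq> 0 \<Longrightarrow> sdeg ts = - n"
  shows "contract g x (odot g W \<omega> \<mu>) ys =
    odot g W (contract g x \<omega>) \<mu> ys + sgnpow ((i - 1) * n) (odot g W \<omega> (contract g x \<mu>) ys)"
proof -
  have ms: "module (scl W)" using W unfolding vector_space_def module_def by simp
  have scl0: "scl W 0 v = 0" "scl W c 0 = 0" for v c
    using module.scale_zero_left[OF ms] module.scale_zero_right[OF ms] by blast+
  have sclW: "scl W (sgnpow k c) v = sgnpow k (scl W c v)" 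
      "scl W c (sgnpow k v) = sgnpow k (scl W c v)" for k c v
    using module.scale_minus_left[OF ms] module.scale_minus_right[OF ms]
    unfolding sgnpow_def by auto
  let ?G = "\<lambda>\<alpha> \<beta> ts. \<Sum>S\<in>Pow {..<length ts}.
     sgnpow (koszul ts S + sdeg (nths ts (- S)) * sdeg (nths ts S))
       (scl W (\<alpha> (map snd (nths ts S))) (\<beta> (map snd (nths ts (- S)))))"
  have odot: "odot g W \<alpha> \<beta> zs = hom_ext g (?G \<alpha> \<beta>) zs" for \<alpha> \<beta> zs
    by (simp add: odot_def cl_ext_def)
  show ?thesis
  proof (cases "x = 0")
    case True
    show ?thesis
      unfolding odot contract_homogeneous[OF g x] if_P[OF True] by (simp add: scl0 hom_ext_zero)
  next
    case False
    have "contract g x (odot g W \<omega> \<mu>) ys =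
       hom_ext g (\<lambda>ts. ?G (contract g x \<omega>) \<mu> ts + sgnpow ((i - 1) * n) (?G \<omega> (contract g x \<mu>) ts)) ys"
      unfolding contract_homogeneous[OF g x, of "odot g W \<omega> \<mu>"] if_not_P[OF False]
    proof (rule hom_ext_cong[OF g])
      fix ts assume ts: "tagged g ts" "length ts = length ys"
      have t: "tagged g ((i, x) # ts)" using ts x False by (simp add: tagged_Cons)
      have "odot g W \<omega> \<mu> (x # map snd ts) = ?G \<omega> \<mu> ((i, x) # ts)"
        using hom_ext_tagged[OF g t, of "?G \<omega> \<mu>"] by (simp add: odot)
      also have "\<dots> = (\<Sum>S\<in>Pow {..<length ts}.
         sgnpow ((i - 1) * sdeg (nths ts S) + koszul ts S + (i - 1 + sdeg (nths ts (- S))) * sdeg (nths ts S))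
            (scl W (\<omega> (map snd (nths ts S))) (\<mu> (x # map snd (nths ts (- S)))))
       + sgnpow (koszul ts S + sdeg (nths ts (- S)) * (i - 1 + sdeg (nths ts S)))
            (scl W (\<omega> (x # map snd (nths ts S))) (\<mu> (map snd (nths ts (- S))))))"
        unfolding length_Cons sum_Pow_Suc by (simp add: split_simps)
      finally have 1: "odot g W \<omega> \<mu> (x # map snd ts) = \<dots>" .
      have sumsgn: "sgnpow k (\<Sum>S\<in>A. F S) = (\<Sum>S\<in>A. sgnpow k (F S))" for k A and F :: "nat set \<Rightarrow> 'w"
        by (simp add: sgnpow_def sum_negf)
      have addsgn: "sgnpow k (a + b) = sgnpow k a + sgnpow k b" for k and a b :: 'w
        by (simp add: sgnpow_def)
      have sgneq: "sgnpow k v = sgnpow l v" if "k - l = 2 * t" for k l t and v :: 'w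
        using that by (intro sgnpow_even) simp
      show "sgnpow ((i - 1) * (i - 1 + sdeg ts)) (odot g W \<omega> \<mu> (x # map snd ts)) =
        ?G (contract g x \<omega>) \<mu> ts + sgnpow ((i - 1) * n) (?G \<omega> (contract g x \<mu>) ts)"
        unfolding 1 sumsgn addsgn sum.distrib[symmetric]
      proof (rule sum.cong[OF refl])
        fix S
        have c: "contract g x \<alpha> (map snd (nths ts T)) =
          sgnpow ((i - 1) * (i - 1 + sdeg (nths ts T))) (\<alpha> (x # map snd (nths ts T)))" for \<alpha> :: "'g list \<Rightarrow> 'k" and T
          using contract_tagged[OF g x tagged_nths[OF ts(1)]] False by simp
        have c': "contract g x \<alpha> (map snd (nths ts T)) =
          sgnpow ((i - 1) * (i - 1 + sdeg (nths ts T))) (\<alpha> (x # map snd (nths ts T)))" for \<alpha> :: "'g list \<Rightarrow> 'w" and T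
          using contract_tagged[OF g x tagged_nths[OF ts(1)]] False by simp
        have d: "sdeg (nths ts S) = - n" if "\<omega> (map snd (nths ts S)) \<noteq> 0"
          using deg tagged_nths[OF ts(1)] that by blast
        let ?a = "sdeg (nths ts S)" and ?b = "sdeg (nths ts (- S))" and ?k = "koszul ts S"
        show "sgnpow ((i - 1) * (i - 1 + sdeg ts))
           (sgnpow ((i - 1) * sdeg (nths ts S) + koszul ts S + (i - 1 + sdeg (nths ts (- S))) * sdeg (nths ts S))
            (scl W (\<omega> (map snd (nths ts S))) (\<mu> (x # map snd (nths ts (- S))))))
          + sgnpow ((i - 1) * (i - 1 + sdeg ts)) (sgnpow (koszul ts S + sdeg (nths ts (- S)) * (i - 1 + sdeg (nths ts S)))
            (scl W (\<omega> (x # map snd (nths ts S))) (\<mu> (map snd (nths ts (- S)))))) =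
          sgnpow (koszul ts S + sdeg (nths ts (- S)) * sdeg (nths ts S))
            (scl W (contract g x \<omega> (map snd (nths ts S))) (\<mu> (map snd (nths ts (- S))))) +
          sgnpow ((i - 1) * n) (sgnpow (koszul ts S + sdeg (nths ts (- S)) * sdeg (nths ts S))
            (scl W (\<omega> (map snd (nths ts S))) (contract g x \<mu> (map snd (nths ts (- S))))))"
          unfolding c c' sclW sgnpow_sgnpow sdeg_split[of ts S, symmetric]
        proof (rule trans[OF add.commute], rule arg_cong2[where f = "(+)"])
          let ?v = "scl W (\<omega> (x # map snd (nths ts S))) (\<mu> (map snd (nths ts (- S))))"
          show "sgnpow ((i - 1) * (i - 1 + (?a + ?b)) + (?k + ?b * (i - 1 + ?a))) ?v =
              sgnpow (?k + ?b * ?a + (i - 1) * (i - 1 + ?a)) ?v"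
            by (rule sgneq[of _ _ "?b * (i - 1)"]) (simp add: algebra_simps)
          let ?u = "\<mu> (x # map snd (nths ts (- S)))"
          show "sgnpow ((i - 1) * (i - 1 + (?a + ?b)) + ((i - 1) * ?a + ?k + (i - 1 + ?b) * ?a))
              (scl W (\<omega> (map snd (nths ts S))) ?u) =
            sgnpow ((i - 1) * n + (?k + ?b * ?a + (i - 1) * (i - 1 + ?b)))
              (scl W (\<omega> (map snd (nths ts S))) ?u)"
          proof (cases "\<omega> (map snd (nths ts S)) = 0")
            case False
            then have "n = - ?a" using d by simp
            then show ?thesis
              by (intro sgneq[of _ _ "2 * ((i - 1) * ?a)"]) (simp add: algebra_simps)
          qed (simp add: scl0)
        qed
      qed
    qed
    then show ?thesis by (simp add: hom_ext_add hom_ext_sgnpow odot)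
  qed
qed

text \<open>The operator \<open>\<iota>\<^bsub>b[1]\<^esub>\<close> for \<open>b \<in> C(g) \<otimes> g\<close>; for \<open>b = \<omega> \<otimes> x\<close> it is \<open>\<omega> \<odot> \<iota>\<^bsub>x[1]\<^esub>\<close>,
  see \<open>contract_by_tensor\<close>.\<close>

definition contract_by ::
  "('k, 'g::ab_group_add, 'x) gspace_scheme \<Rightarrow> ('g list \<Rightarrow> 'g) \<Rightarrow> ('g list \<Rightarrow> 'w::ab_group_add)
   \<Rightarrow> 'g list \<Rightarrow> 'w" where
  "contract_by g b \<mu> = cl_ext g 0 (\<lambda>x. contract g x \<mu>) b"

lemma cl_ext_tagged:
  assumes "fd_graded_space g" "tagged g ts"
  shows "cl_ext g p T \<beta> (map snd ts) = (\<Sum>S \<in> Pow {..<length ts}.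
     sgnpow (koszul ts S + sdeg (nths ts (- S)) * sdeg (nths ts S) + p * sdeg (nths ts S))
       (T (\<beta> (map snd (nths ts S))) (map snd (nths ts (- S)))))"
  unfolding cl_ext_def hom_ext_tagged[OF assms] ..

lemma contract_by_tensor:
  assumes g: "fd_graded_space g" and \<mu>: "\<mu> \<in> cochains g W"
  shows "contract_by g (\<lambda>xs. scl g (\<omega> xs) x) \<mu> = odot g W \<omega> (contract g x \<mu>)"
proof -
  have lin: "Vector_Spaces.linear (scl g) (scl W) (\<lambda>x. \<mu> (as @ x # bs))" for as bs
    using \<mu> unfolding cochains_def by blast
  interpret L: Vector_Spaces.linear "scl g" "scl W" "\<lambda>x. \<mu> ([] @ x # [])"
    by (rule lin)
  have hs: "hom_ext g (\<lambda>ts. scl W c (F ts)) ys = scl W c (hom_ext g F ys)" for c F ys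
    by (induction ys arbitrary: F) (simp_all add: L.vs2.scale_sum_right)
  have sgs: "scl W c (sgnpow k v) = sgnpow k (scl W c v)" for c k v
    by (simp add: sgnpow_def)
  have comps: "component g i (scl g c x) = scl g c (component g i x)" for i c x
  proof (cases "c = 0")
    case True
    have "decomposition g 0 (\<lambda>i. 0)"
      using g L.vs1.subspace_0 unfolding decomposition_def fd_graded_space_def by auto
    then show ?thesis using component_eqI[OF g] True by simp
  next
    case False
    have "decomposition g (scl g c x) (\<lambda>i. scl g c (component g i x))"
      using component_decomposition[OF g, of x] False g L.vs1.subspace_scale 
      unfolding decomposition_def fd_graded_space_def
      by (auto simp: L.vs1.scale_sum_right[symmetric])
    then show ?thesis using component_eqI[OF g] by simp
  qed
  have "contract g (scl g c x) \<mu> ys = scl W c (contract g x \<mu> ys)" for c ys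
  proof (cases "c = 0")
    case True
    have "component g i 0 = 0" for i using comps[of i 0 0] by simp
    then show ?thesis using True by (simp add: contract_def)
  next
    case False
    have "\<mu> (scl g c y # zs) = scl W c (\<mu> (y # zs))" for y zs
      using lin[of "[]" zs] module_hom.scale unfolding module_hom_iff_linear[symmetric] by fastforce
    then show ?thesis using False
      unfolding contract_def
      by (simp add: comps L.vs2.scale_sum_right sgs[symmetric] hs)
  qed
  then show ?thesis by (simp add: contract_by_def odot_def fun_eq_iff cl_ext_def)
qed

section \<open>The Chevalley-Eilenberg differential\<close>

text \<open>
  Let \<open>\<theta>\<^sub>a\<close> be a basis of \<open>g\<^sup>\<or>[-1]\<close> and \<open>e\<^sub>a\<close> the basis of \<open>g\<close> with
  \<open>\<iota>\<^bsub>e\<^sub>a[1]\<^esub>\<theta>\<^sub>b = \<delta>\<^sub>a\<^sub>b\<close>. Contractions being derivations (\<open>contract_odot\<close>), the derivation \<open>D\<close> of \<open>C(g)\<close> with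
  prescribed values \<open>D \<theta>\<^sub>a\<close> is \<open>\<Sum>\<^sub>a D \<theta>\<^sub>a \<odot> \<iota>\<^bsub>e\<^sub>a[1]\<^esub>\<close>, that is, \<open>\<iota>\<^bsub>b[1]\<^esub>\<close> for
  \<open>b = \<Sum>\<^sub>a D \<theta>\<^sub>a \<otimes> e\<^sub>a\<close>. The elements \<open>b\<close> belonging to \<open>d\<^sub>0\<close> and \<open>d\<^sub>1\<close> are \<open>CE_field0\<close> and
  \<open>CE_field1\<close>; the values of \<open>d\<^sub>0\<close> and \<open>d\<^sub>1\<close> on generators are computed in \<open>CE_diff0_generator\<close>
  and \<open>CE_diff1_generator\<close>. The same formula, for \<open>W\<close>-valued arguments, is
  \<open>d\<^sub>C\<^sub>E \<otimes> id\<^sub>W\<close>.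
\<close>

definition CE_field0 :: "('k, 'g::ab_group_add) dgla \<Rightarrow> 'g list \<Rightarrow> 'g" where
  "CE_field0 g xs = (case xs of [x] \<Rightarrow> - dif g x | _ \<Rightarrow> 0)"

definition CE_field1 :: "('k, 'g::ab_group_add) dgla \<Rightarrow> 'g list \<Rightarrow> 'g" where
  "CE_field1 g = hom_ext g (\<lambda>ts. case ts of [(i, x), (j, y)] \<Rightarrow> sgnpow i (brk g x y) | _ \<Rightarrow> 0)"

definition CE_diff0 ::
  "('k, 'g::ab_group_add) dgla \<Rightarrow> ('g list \<Rightarrow> 'w::ab_group_add) \<Rightarrow> 'g list \<Rightarrow> 'w" where
  "CE_diff0 g = contract_by g (CE_field0 g)"

definition CE_diff1 ::
  "('k, 'g::ab_group_add) dgla \<Rightarrow> ('g list \<Rightarrow> 'w::ab_group_add) \<Rightarrow> 'g list \<Rightarrow> 'w" where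
  "CE_diff1 g = contract_by g (CE_field1 g)"

definition CE_diff ::
  "('k, 'g::ab_group_add) dgla \<Rightarrow> ('g list \<Rightarrow> 'w::ab_group_add) \<Rightarrow> 'g list \<Rightarrow> 'w" where
  "CE_diff g \<mu> = (\<lambda>xs. CE_diff0 g \<mu> xs + CE_diff1 g \<mu> xs)"

text \<open>
  For \<open>\<omega> = \<xi>[-1]\<close> with \<open>\<xi> \<in> g\<^sup>\<or>\<close> of degree \<open>q\<close>; note that \<open>(-1)\<^bsup>|\<xi>|\<^esup> \<xi>(d x)\<close> is the value on
  \<open>x\<close> of the differential of \<open>g\<^sup>\<or>[-1]\<close>, which is minus the one of \<open>g\<^sup>\<or>\<close>.
\<close>

lemma
  assumes "dg_Lie_algebra g" and \<omega>: "\<omega> \<in> cochains_of_length 1 g W"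
    and deg: "\<And>j z. z \<in> hom g j \<Longrightarrow> j \<noteq> - q \<Longrightarrow> \<omega> [z] = 0"
    and x: "x \<in> hom g i"
  shows CE_diff0_generator: "CE_diff0 g \<omega> [x] = sgnpow q (\<omega> [dif g x])"
    and CE_diff1_generator:
      "y \<in> hom g j \<Longrightarrow> CE_diff1 g \<omega> [x, y] = sgnpow (q + 1 + i) (\<omega> [brk g x y])"
proof -
  have g: "fd_graded_space g" 
    and bl: "Vector_Spaces.linear (scl g) (scl g) (\<lambda>x. brk g x y)"
     "Vector_Spaces.linear (scl g) (scl g) (brk g x)"
     "Vector_Spaces.linear (scl g) (scl g) (dif g)" for x y
    using assms(1) unfolding dg_Lie_algebra_def by blast+
  have dd: "\<forall>i. \<forall>x\<in>hom g i. dif g x \<in> hom g (i + 1)"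
    using assms(1) unfolding dg_Lie_algebra_def by (elim conjE)
  have wl: "Vector_Spaces.linear (scl g) (scl W) (\<lambda>x. \<omega> ([] @ x # []))"
    and w0: "length xs \<noteq> 1 \<Longrightarrow> \<omega> xs = 0" for xs
    using \<omega> unfolding cochains_of_length_def cochains_def by blast+
  interpret L: Vector_Spaces.linear "scl g" "scl W" "\<lambda>x. \<omega> ([] @ x # [])" by (rule wl)
  interpret D: Vector_Spaces.linear "scl g" "scl g" "dif g" by (rule bl)
  interpret B1: Vector_Spaces.linear "scl g" "scl g" "\<lambda>x. brk g x w" for w by (rule bl)
  interpret B2: Vector_Spaces.linear "scl g" "scl g" "brk g w" for w by (rule bl)
  have w00: "\<omega> [0] = 0" "\<omega> [- z] = - \<omega> [z]" for z using L.zero L.neg[of z] by simp_all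
  have sub: "module.subspace (scl g) (hom g i)" for i
    using g unfolding fd_graded_space_def by blast
  have c: "contract g z \<omega> [] = sgnpow (q + 1) (\<omega> [z])" if "z \<in> hom g k" for z k
    using contract_tagged[OF g that, of "[]" \<omega>] deg[OF that] w00
    by (cases "k = - q") (auto simp: tagged_def sgnpow_def)
  have c0: "contract g 0 \<omega> zs = 0" for zs
    using contract_homogeneous[OF g L.vs1.subspace_0[OF sub]] by simp
  have dx: "- dif g x \<in> hom g (i + 1)"
  proof -
    have "dif g x \<in> hom g (i + 1)" using dd x by blast
    then show ?thesis by (rule L.vs1.subspace_neg[OF sub])
  qed
  show "CE_diff0 g \<omega> [x] = sgnpow q (\<omega> [dif g x])"
  proof (cases "x = 0")
    case True
    have "component g k 0 = 0" for k using component_homogeneous[OF g L.vs1.subspace_0[OF sub]] by simp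
    then show ?thesis using True w00 D.zero
      by (simp add: CE_diff0_def contract_by_def cl_ext_def)
  next
    case False
    then have t: "tagged g [(i, x)]" using x by (simp add: tagged_def)
    have "Pow {..<Suc 0} = {{}, {0}}" by auto
    then show ?thesis
      using cl_ext_tagged[OF g t, of 0 "\<lambda>z. contract g z \<omega>" "CE_field0 g"] c[OF dx]
      by (simp add: CE_diff0_def contract_by_def CE_field0_def c0 koszul_Cons w00 sgnpow_def)
  qed
  assume y: "y \<in> hom g j"
  have xy: "brk g x y \<in> hom g (i + j)"
  proof -
    have "graded_bilinear (as_gvec g) (as_gvec g) (as_gvec g) (brk g)"
      using assms(1) unfolding dg_Lie_algebra_def graded_Lie_algebra_def by (elim conjE)
    then have "\<forall>i j. \<forall>x\<in>gcomp (as_gvec g) i. \<forall>y\<in>gcomp (as_gvec g) j.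
        brk g x y \<in> gcomp (as_gvec g) (i + j)"
      unfolding graded_bilinear_def by blast
    then show ?thesis using x y by (simp add: as_gvec_def)
  qed
  then have sxy: "sgnpow i (brk g x y) \<in> hom g (i + j)"
    using L.vs1.subspace_neg[OF sub] by (simp add: sgnpow_def)
  show "CE_diff1 g \<omega> [x, y] = sgnpow (q + 1 + i) (\<omega> [brk g x y])"
  proof (cases "x = 0 \<or> y = 0")
    case True
    have h0: "hom_ext g F [x, y] = 0" for F :: "(int \<times> 'b) list \<Rightarrow> 'c"
      unfolding hom_ext_homogeneous[OF g x] hom_ext_homogeneous[OF g y] using True by auto
    have "brk g x y = 0" using True B1.zero B2.zero by auto
    then show ?thesis
      by (simp add: CE_diff1_def contract_by_def cl_ext_def h0 w00 del: hom_ext.simps(2))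
  next
    case False
    then have t: "tagged g [(i, x), (j, y)]" using x y by (simp add: tagged_def)
    have P: "Pow {..<Suc (Suc 0)} = {{}, {0}, {1}, {0, 1}}" by (auto simp: less_Suc_eq)
    have f: "CE_field1 g [] = 0" "CE_field1 g [z] = 0" for z
      by (simp_all add: CE_field1_def)
    have h2: "hom_ext g F [x, y] = F [(i, x), (j, y)]" for F :: "(int \<times> 'b) list \<Rightarrow> 'b"
      using hom_ext_tagged[OF g t, of F] by (simp del: hom_ext.simps)
    have f2: "CE_field1 g [x, y] = sgnpow i (brk g x y)"
      by (simp add: CE_field1_def h2 del: hom_ext.simps)
    show ?thesis
      using cl_ext_tagged[OF g t, of 0 "\<lambda>z. contract g z \<omega>" "CE_field1 g"] c[OF sxy]
      by (simp add: CE_diff1_def contract_by_def P nths_Cons f f2 c0 koszul_Cons w00)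
        (simp add: w00 sgnpow_def)
  qed
qed

section \<open>Modules and morphisms up to homotopy\<close>

text \<open>A locally finite family of linear maps \<open>T\<^sub>k : V \<rightarrow> C\<^sup>k(g, W)\<close> of degree \<open>p\<close>.\<close>

definition locally_finite_family ::
  "('k::field, 'g::ab_group_add, 'x) gspace_scheme \<Rightarrow> ('k, 'v::ab_group_add, 'y) gspace_scheme
   \<Rightarrow> ('k, 'w::ab_group_add, 'z) gspace_scheme \<Rightarrow> int \<Rightarrow> (nat \<Rightarrow> 'v \<Rightarrow> 'g list \<Rightarrow> 'w) \<Rightarrow> bool" where
  "locally_finite_family g V W p T \<longleftrightarrow>
     (\<forall>k m. T k m \<in> cochains_of_length k g W) \<and>
     (\<forall>k xs. Vector_Spaces.linear (scl V) (scl W) (\<lambda>m. T k m xs)) \<and>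
     (\<forall>k i. \<forall>m\<in>hom V i. has_total_degree g W (i + p) (T k m)) \<and>
     (\<forall>m. \<exists>n. \<forall>k>n. \<forall>xs. T k m xs = 0)"

text \<open>
  The sums \<open>\<Sum>\<^sub>k\<^sub>\<ge>\<^sub>0 T\<^sub>k m\<close> and \<open>\<Sum>\<^sub>k\<^sub>\<ge>\<^sub>1 T\<^sub>k m\<close>. As \<open>T\<^sub>k m\<close> lies in \<open>C\<^sup>k(g, W)\<close>, the terms with \<open>k\<close> larger
  than the number of arguments contribute nothing.
\<close>

definition family_sum :: "(nat \<Rightarrow> 'v \<Rightarrow> 'g list \<Rightarrow> 'w::ab_group_add) \<Rightarrow> 'v \<Rightarrow> 'g list \<Rightarrow> 'w" where
  "family_sum T m xs = (\<Sum>k\<in>{0..length xs}. T k m xs)"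

definition family_sum1 :: "(nat \<Rightarrow> 'v \<Rightarrow> 'g list \<Rightarrow> 'w::ab_group_add) \<Rightarrow> 'v \<Rightarrow> 'g list \<Rightarrow> 'w" where
  "family_sum1 T m xs = (\<Sum>k\<in>{1..length xs}. T k m xs)"

record ('k, 'g, 'm) inf_mod = "('k, 'm) gspace" +
  mop :: "nat \<Rightarrow> 'm \<Rightarrow> 'g list \<Rightarrow> 'm"

definition mod_diff :: "('k, 'g, 'm) inf_mod \<Rightarrow> 'm \<Rightarrow> 'm" where
  "mod_diff M m = Pr (mop M 0 m)"

definition d_tot ::
  "('k, 'g::ab_group_add) dgla \<Rightarrow> ('k, 'g, 'm::ab_group_add) inf_mod
   \<Rightarrow> ('g list \<Rightarrow> 'm) \<Rightarrow> 'g list \<Rightarrow> 'm" where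
  "d_tot g M \<mu> = (\<lambda>xs. CE_diff g \<mu> xs + cl_ext g 1 (family_sum (mop M)) \<mu> xs)"

text \<open>
  A locally finite module up to homotopy. Its underlying complex is \<open>(M, d\<^sub>0)\<close>, where
  \<open>d\<^sub>0 = mod_diff M\<close>; that \<open>d\<^sub>0\<close> squares to zero is part of the condition on \<open>d_tot\<close>.
\<close>

definition inf_module ::
  "('k::field, 'g::ab_group_add) dgla \<Rightarrow> ('k, 'g, 'm::ab_group_add) inf_mod \<Rightarrow> bool" where
  "inf_module g M \<longleftrightarrow>
     fd_graded_space M \<and>
     locally_finite_family g M M 1 (mop M) \<and>
     (\<forall>\<mu>\<in>cochains g M. \<forall>xs. d_tot g M (d_tot g M \<mu>) xs = 0)"

definition inf_morphism ::
  "('k::field, 'g::ab_group_add) dgla \<Rightarrow> ('k, 'g, 'm::ab_group_add) inf_mod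
   \<Rightarrow> ('k, 'g, 'n::ab_group_add) inf_mod \<Rightarrow> (nat \<Rightarrow> 'm \<Rightarrow> 'g list \<Rightarrow> 'n) \<Rightarrow> bool" where
  "inf_morphism g M N f \<longleftrightarrow>
     locally_finite_family g M N 0 f \<and>
     (\<forall>\<mu>\<in>cochains g M.
        cl_ext g 0 (family_sum f) (d_tot g M \<mu>) = d_tot g N (cl_ext g 0 (family_sum f) \<mu>))"

text \<open>The operation \<open>d\<^sub>1\<close> of the adjoint module is the one with \<open>\<iota>\<^bsub>x[1]\<^esub>(d\<^sub>1 y) = [x, y]\<close>,
  see \<open>contract_adjoint\<close>.\<close>

definition adjoint_op :: "('k, 'g::ab_group_add) dgla \<Rightarrow> nat \<Rightarrow> 'g \<Rightarrow> 'g list \<Rightarrow> 'g" where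
  "adjoint_op g k y =
     (if k = 0 then incl0 (dif g y)
      else if k = 1 then
        hom_ext g (\<lambda>ts. case ts of [(i, x)] \<Rightarrow> sgnpow (i - 1) (brk g x y) | _ \<Rightarrow> 0)
      else (\<lambda>xs. 0))"

lemma contract_adjoint:
  assumes "dg_Lie_algebra g"
  shows "contract g x (adjoint_op g 1 y) [] = brk g x y"
proof -
  have g: "fd_graded_space g" 
    and lin: "Vector_Spaces.linear (scl g) (scl g) (\<lambda>x. brk g x y)"
    using assms unfolding dg_Lie_algebra_def by blast+
  interpret L: Vector_Spaces.linear "scl g" "scl g" "\<lambda>x. brk g x y" by (rule lin)
  have dec: "decomposition g x (\<lambda>i. component g i x)" by (rule component_decomposition[OF g])
  have 1: "hom_ext g F [component g i x] = F [(i, component g i x)]" 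
    if "component g i x \<noteq> 0" for F :: "(int \<times> 'b) list \<Rightarrow> 'b" and i
    using that dec hom_ext_homogeneous[OF g, of "component g i x" i F "[]"]
    unfolding decomposition_def by simp
  have "contract g x (adjoint_op g 1 y) [] = (\<Sum>i | component g i x \<noteq> 0. brk g (component g i x) y)"
    unfolding contract_def adjoint_op_def
    using 1 by (auto simp add: sgnpow_def intro!: sum.cong simp del: hom_ext.simps(2) simp add: hom_ext.simps(2)[of _ _ x])
  also have "\<dots> = brk g (\<Sum>i | component g i x \<noteq> 0. component g i x) y"
    by (simp add: L.sum)
  finally show ?thesis using dec unfolding decomposition_def by simp
qed

definition adjoint :: "('k, 'g::ab_group_add) dgla \<Rightarrow> ('k, 'g, 'g) inf_mod" where
  "adjoint g = \<lparr>scl = scl g, hom = hom g, mop = adjoint_op g\<rparr>"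

definition weak_Loday_Pirashvili_module ::
  "('k::field, 'g::ab_group_add) dgla \<Rightarrow> ('k, 'g, 'm::ab_group_add) inf_mod
   \<Rightarrow> (nat \<Rightarrow> 'm \<Rightarrow> 'g list \<Rightarrow> 'g) \<Rightarrow> bool" where
  "weak_Loday_Pirashvili_module g M f \<longleftrightarrow> inf_module g M \<and> inf_morphism g M (adjoint g) f"

section \<open>Tangent cohomology\<close>

text \<open>
  Cohomology classes are cosets of \<open>range d\<close>. An operation on representatives is transported to
  cosets as in \<open>UN_equiv_class\<close>: the union of all resulting classes, which is a single class
  exactly if the operation is well defined on classes.
\<close>

definition cls :: "('v::ab_group_add \<Rightarrow> 'v) \<Rightarrow> 'v \<Rightarrow> 'v set" where
  "cls d v = (\<lambda>w. v + d w) ` UNIV"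

definition lift_cls1 :: "('w::ab_group_add \<Rightarrow> 'w) \<Rightarrow> ('v \<Rightarrow> 'w) \<Rightarrow> 'v set \<Rightarrow> 'w set" where
  "lift_cls1 d F U = (\<Union>u\<in>U. cls d (F u))"

definition lift_cls2 ::
  "('w::ab_group_add \<Rightarrow> 'w) \<Rightarrow> ('u \<Rightarrow> 'v \<Rightarrow> 'w) \<Rightarrow> 'u set \<Rightarrow> 'v set \<Rightarrow> 'w set" where
  "lift_cls2 d F U V = (\<Union>u\<in>U. \<Union>v\<in>V. cls d (F u v))"

definition cohomology ::
  "('k, 'v::ab_group_add, 'x) gspace_scheme \<Rightarrow> ('v \<Rightarrow> 'v) \<Rightarrow> ('k, 'v set) gvec" where
  "cohomology V d =
     \<lparr>gcomp = (\<lambda>i. cls d ` {v \<in> hom V i. d v = 0}),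
      gadd = lift_cls2 d (+),
      gzero = cls d 0,
      gsmult = (\<lambda>c. lift_cls1 d (scl V c))\<rparr>"

definition H_tan_Lie :: "('k, 'g::ab_group_add) dgla \<Rightarrow> ('k, 'g set) gvec" where
  "H_tan_Lie g = cohomology g (dif g)"

definition tan_bracket :: "('k, 'g::ab_group_add) dgla \<Rightarrow> 'g set \<Rightarrow> 'g set \<Rightarrow> 'g set" where
  "tan_bracket g = lift_cls2 (dif g) (brk g)"

definition H_tan_mod :: "('k, 'g, 'm::ab_group_add) inf_mod \<Rightarrow> ('k, 'm set) gvec" where
  "H_tan_mod M = cohomology M (mod_diff M)"

definition tan_action ::
  "('k, 'g::ab_group_add) dgla \<Rightarrow> ('k, 'g, 'm::ab_group_add) inf_mod \<Rightarrow> 'g set \<Rightarrow> 'm set \<Rightarrow> 'm set"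
  where
  "tan_action g M = lift_cls2 (mod_diff M) (\<lambda>x m. Pr (contract g x (mop M 1 m)))"

definition tan_map ::
  "('k, 'g::ab_group_add) dgla \<Rightarrow> (nat \<Rightarrow> 'm \<Rightarrow> 'g list \<Rightarrow> 'g) \<Rightarrow> 'm set \<Rightarrow> 'g set" where
  "tan_map g f = lift_cls1 (dif g) (\<lambda>m. Pr (f 0 m))"

section \<open>The binary bracket\<close>

text \<open>
  \<open>M[1]\<close> has the same underlying vectors as \<open>M\<close>, and \<open>m[1]\<close> is represented by \<open>m\<close>; likewise an element of
  \<open>C(g, M[1])\<close> is represented by the element of \<open>C(g, M)\<close> that it turns into under the shift.
  \<open>lambda2_gen g M f i m\<^sub>1 m\<^sub>2\<close> is the value on \<open>m\<^sub>1[1], m\<^sub>2[1]\<close> for \<open>m\<^sub>1\<close> of degree \<open>i\<close>. Since the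
  bracket has degree 1, \<open>\<lambda>\<^sub>2(m\<^sub>1[1], -)\<close> has degree \<open>1 + |m\<^sub>1[1]| = i\<close>; thus
  \<open>\<lambda>\<^sub>2(\<omega>\<^sub>1 \<otimes> m\<^sub>1[1], \<omega>\<^sub>2 \<otimes> m\<^sub>2[1]) = (-1)\<^bsup>|\<omega>\<^sub>1| + i |\<omega>\<^sub>2|\<^esup> \<omega>\<^sub>1 \<odot> \<omega>\<^sub>2 \<odot> \<lambda>\<^sub>2(m\<^sub>1[1], m\<^sub>2[1])\<close>.
\<close>

definition lambda2_gen ::
  "('k, 'g::ab_group_add) dgla \<Rightarrow> ('k, 'g, 'm::ab_group_add) inf_mod
   \<Rightarrow> (nat \<Rightarrow> 'm \<Rightarrow> 'g list \<Rightarrow> 'g) \<Rightarrow> int \<Rightarrow> 'm \<Rightarrow> 'm \<Rightarrow> 'g list \<Rightarrow> 'm" where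
  "lambda2_gen g M f i m1 m2 =
     (\<lambda>xs. sgnpow (i - 1) (contract_by g (family_sum f m1) (family_sum1 (mop M) m2) xs))"

definition lambda2 ::
  "('k, 'g::ab_group_add) dgla \<Rightarrow> ('k, 'g, 'm::ab_group_add) inf_mod
   \<Rightarrow> (nat \<Rightarrow> 'm \<Rightarrow> 'g list \<Rightarrow> 'g) \<Rightarrow> ('g list \<Rightarrow> 'm) \<Rightarrow> ('g list \<Rightarrow> 'm) \<Rightarrow> 'g list \<Rightarrow> 'm" where
  "lambda2 g M f \<beta> \<gamma> =
     cl_ext g 1
       (\<lambda>m xs. \<Sum>i | component M i m \<noteq> 0. cl_ext g i (lambda2_gen g M f i (component M i m)) \<gamma> xs) \<beta>"

end

theory Submission
  imports Defs
begin

text \<open>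
  For \<open>m \<in> M\<close>, the identity \<open>d_tot (d_tot (1 \<otimes> m)) = 0\<close> evaluated on no argument, on \<open>x[1]\<close> and on
  \<open>x[1], y[1]\<close> says that \<open>d\<^sub>0\<close> squares to zero, that \<open>x \<cdot> m\<close> is a chain map \<open>g \<otimes> M \<rightarrow> M\<close>, and that
  on cocycles this pairing is a Lie action up to the exact term coming from \<open>d\<^sub>2\<close>. In the same way the
  morphism equation on \<open>1 \<otimes> m\<close> says that \<open>f\<^sub>0\<close> is a chain map and is equivariant up to the exact
  term coming from \<open>f\<^sub>1\<close>. Only \<open>f\<^sub>0\<close> and \<open>d\<^sub>1\<close> contribute to the component of
  \<open>\<lambda>\<^sub>2(u[1], v[1])\<close> in \<open>M\<close>.
\<close>

section \<open>Cohomology of graded complexes\<close>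

text \<open>The axioms on carriers write signs as scalars, the cochain formulas as
  \<open>sgnpow\<close>; this and the next lemma translate between the two.\<close>

lemma scl_powi:
  assumes "vector_space (scl V)"
  shows "scl V ((-1) powi n) v = sgnpow n v"
proof -
  interpret vector_space "scl V" by fact
  show ?thesis by (cases "even n") (simp_all add: sgnpow_def power_int_minus_left)
qed

lemma scl_minus_powi:
  assumes "vector_space (scl V)"
  shows "scl V (- ((-1) powi n)) v = - sgnpow n v"
proof -
  interpret vector_space "scl V" by fact
  show ?thesis using scl_powi[OF assms] by simp
qed

lemma sgnpow_add: "sgnpow n (v + w) = sgnpow n v + sgnpow n w"
  by (simp add: sgnpow_def)

lemma sgnpow_inject: "sgnpow n v = sgnpow n w \<longleftrightarrow> v = w"
  by (simp add: sgnpow_def)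

lemma sgnpow_even_id [simp]: "even n \<Longrightarrow> sgnpow n v = v"
  by (simp add: sgnpow_def)

text \<open>A coset is nonempty, so a union over it whose members all equal \<open>C\<close> is
  \<open>C\<close> itself.\<close>

lemma lift_cls1_eqI:
  assumes "\<And>a. cls e (F (v + d a)) = C"
  shows "lift_cls1 e F (cls d v) = C"
  using assms by (simp add: lift_cls1_def cls_def[of d])

lemma lift_cls2_eqI:
  assumes "\<And>a b. cls e (F (u + d a) (v + d' b)) = C"
  shows "lift_cls2 e F (cls d u) (cls d' v) = C"
  using assms by (simp add: lift_cls2_def cls_def[of d] cls_def[of d'])

text \<open>Serves both \<open>g\<close> with \<open>dif g\<close> and \<open>M\<close> with
  \<open>mod_diff M\<close>, so that cohomology is treated once.\<close>

locale cochain_complex =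
  fixes V :: "('k::field, 'v::ab_group_add, 'x) gspace_scheme" and d :: "'v \<Rightarrow> 'v"
  assumes fd: "fd_graded_space V"
    and linear: "Vector_Spaces.linear (scl V) (scl V) d"
    and degree: "x \<in> hom V i \<Longrightarrow> d x \<in> hom V (i + 1)"
    and square: "d (d x) = 0"
begin

sublocale linear: Vector_Spaces.linear "scl V" "scl V" d
  by (rule linear)

lemma subspace_hom: "linear.vs1.subspace (hom V i)"
  using fd unfolding fd_graded_space_def by blast

lemmas hom_zero = linear.vs1.subspace_0[OF subspace_hom]
  and hom_add = linear.vs1.subspace_add[OF subspace_hom]
  and hom_neg = linear.vs1.subspace_neg[OF subspace_hom]
  and hom_scale = linear.vs1.subspace_scale[OF subspace_hom]

lemma hom_sgnpow: "x \<in> hom V i \<Longrightarrow> sgnpow n x \<in> hom V i"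
  by (simp add: sgnpow_def hom_neg)

lemma component_hom: "component V i v \<in> hom V i"
  using component_decomposition[OF fd] by (simp add: decomposition_def)

lemma sum_components: "(\<Sum>i | component V i v \<noteq> 0. component V i v) = v"
  using component_decomposition[OF fd, of v] by (simp add: decomposition_def)

lemma cls_add: "cls d (v + d w) = cls d v"
proof -
  have "v + d w + d u \<in> cls d v" "v + d u \<in> cls d (v + d w)" for u
  proof -
    have "v + d w + d u = v + d (w + u)" "v + d u = v + d w + d (u - w)"
      by (simp_all add: linear.add linear.diff)
    then show "v + d w + d u \<in> cls d v" "v + d u \<in> cls d (v + d w)"
      unfolding cls_def by blast+
  qed
  then show ?thesis unfolding cls_def by blast
qed

lemma d_add_exact: "d (v + d w) = d v"
  by (simp add: linear.add square)

lemma gcomp_cohomologyE: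
  assumes "X \<in> gcomp (cohomology V d) i"
  obtains v where "v \<in> hom V i" "d v = 0" "X = cls d v"
  using assms by (auto simp: cohomology_def)

lemma gcomp_cohomologyI: "v \<in> hom V i \<Longrightarrow> d v = 0 \<Longrightarrow> cls d v \<in> gcomp (cohomology V d) i"
  by (simp add: cohomology_def)

lemma gadd_cls: "gadd (cohomology V d) (cls d v) (cls d w) = cls d (v + w)"
proof -
  have "cls d (v + d a + (w + d b)) = cls d (v + w)" for a b
    using cls_add[of "v + w" "a + b"] by (simp add: linear.add algebra_simps)
  then show ?thesis
    by (simp add: cohomology_def lift_cls2_eqI)
qed

lemma gsmult_cls: "gsmult (cohomology V d) c (cls d v) = cls d (scl V c v)"
proof -
  have "cls d (scl V c (v + d w)) = cls d (scl V c v)" for w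
    using cls_add[of "scl V c v" "scl V c w"]
    by (simp add: linear.scale linear.vs1.scale_right_distrib)
  then show ?thesis by (simp add: cohomology_def lift_cls1_eqI)
qed

lemma gzero_cls: "gzero (cohomology V d) = cls d 0"
  by (simp add: cohomology_def)

lemmas cohomology_ops = gadd_cls gsmult_cls gzero_cls

lemma graded_vector_space_cohomology: "graded_vector_space (cohomology V d)"
proof -
  let ?H = "cohomology V d"
  \<comment> \<open>Negatives are the only axiom asking for a witness: the class of
    \<open>- v\<close>. The other axioms pass from representatives to classes.\<close>
  have inv: "\<exists>Y\<in>gcomp ?H i. gadd ?H X Y = gzero ?H" if X: "X \<in> gcomp ?H i" for X i
  proof -
    obtain v where v: "v \<in> hom V i" "d v = 0" "X = cls d v"
      by (rule gcomp_cohomologyE[OF X])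
    then show ?thesis
      by (intro bexI[of _ "cls d (- v)"] gcomp_cohomologyI)
        (simp_all add: cohomology_ops hom_neg linear.neg)
  qed
  show ?thesis
    unfolding graded_vector_space_def
    by (intro allI conjI ballI inv; (elim gcomp_cohomologyE)?)
      (auto simp: cohomology_ops hom_zero hom_add hom_scale linear.zero linear.add linear.scale
        linear.vs1.scale_left_distrib linear.vs1.scale_right_distrib algebra_simps
        intro!: gcomp_cohomologyI)
qed

end

section \<open>Bilinear chain maps and the products they induce on cohomology\<close>

locale chain_pairing =
  U: cochain_complex U dU + V: cochain_complex V dV + W: cochain_complex W dW
  for U :: "('k::field, 'u::ab_group_add, 'x) gspace_scheme" and dU
    and V :: "('k, 'v::ab_group_add, 'y) gspace_scheme" and dV
    and W :: "('k, 'w::ab_group_add, 'z) gspace_scheme" and dW +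
  fixes B :: "'u \<Rightarrow> 'v \<Rightarrow> 'w"
  assumes linear_left: "Vector_Spaces.linear (scl U) (scl W) (\<lambda>x. B x y)"
    and linear_right: "Vector_Spaces.linear (scl V) (scl W) (B x)"
    and degree: "x \<in> hom U i \<Longrightarrow> y \<in> hom V j \<Longrightarrow> B x y \<in> hom W (i + j)"
    and Leibniz: "x \<in> hom U i \<Longrightarrow> dW (B x y) = B (dU x) y + sgnpow i (B x (dV y))"
begin

sublocale left: Vector_Spaces.linear "scl U" "scl W" "\<lambda>x. B x y" for y
  by (rule linear_left)

sublocale right: Vector_Spaces.linear "scl V" "scl W" "B x" for x
  by (rule linear_right)

text \<open>The Leibniz rule speaks of homogeneous left arguments, while representatives of a class
  differ by \<open>dU w\<close> with \<open>w\<close> arbitrary. For closed \<open>y\<close> the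
  term carrying the degree-dependent sign vanishes, so the identities for the components of
  \<open>w\<close> add up.\<close>

lemma exact_left:
  assumes "dV y = 0"
  shows "B (dU w) y = dW (B w y)"
proof -
  let ?S = "{i. component U i w \<noteq> 0}"
  have "B (dU (component U i w)) y = dW (B (component U i w) y)" for i
    using Leibniz[OF U.component_hom] assms by (simp add: right.zero)
  then have "B (dU (\<Sum>i\<in>?S. component U i w)) y = dW (B (\<Sum>i\<in>?S. component U i w) y)"
    by (simp add: U.linear.sum left.sum W.linear.sum)
  then show ?thesis by (simp add: U.sum_components)
qed

lemma exact_right:
  assumes "x \<in> hom U i" "dU x = 0"
  shows "B x (dV w) = dW (sgnpow i (B x w))"
  using Leibniz[OF assms(1), of w] assms(2) by (simp add: sgnpow_def W.linear.neg left.zero)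

lemma closed:
  assumes "x \<in> hom U i" "dU x = 0" "dV y = 0"
  shows "dW (B x y) = 0"
  using Leibniz[OF assms(1), of y] assms by (simp add: left.zero right.zero)

lemma lift_cls2_eq:
  assumes x: "x \<in> hom U i" "dU x = 0" and y: "dV y = 0"
  shows "lift_cls2 dW B (cls dU x) (cls dV y) = cls dW (B x y)"
proof -
  have "cls dW (B (x + dU a) (y + dV b)) = cls dW (B x y)" for a b
  proof -
    have "dV (y + dV b) = 0" using y by (simp add: V.d_add_exact)
    \<comment> \<open>Pairing \<open>dU a\<close> with the whole closed element
      \<open>y + dV b\<close> makes \<open>exact_left\<close> cover the cross term of two exact
      elements as well.\<close>
    then have "B (x + dU a) (y + dV b) = B x y + dW (B a (y + dV b) + sgnpow i (B x b))"
      using exact_left[of "y + dV b" a] exact_right[OF x, of b]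
      by (simp only: left.add[of _ _ "y + dV b"] right.add[of x] W.linear.add
          add.assoc add.left_commute add.commute)
    then show ?thesis by (simp add: W.cls_add)
  qed
  then show ?thesis by (rule lift_cls2_eqI)
qed

lemma graded_bilinear_cohomology:
  "graded_bilinear (cohomology U dU) (cohomology V dV) (cohomology W dW) (lift_cls2 dW B)"
  unfolding graded_bilinear_def
  by (intro allI conjI ballI; elim U.gcomp_cohomologyE V.gcomp_cohomologyE)
    (simp_all add: lift_cls2_eq lift_cls2_eq[OF U.hom_add] lift_cls2_eq[OF U.hom_scale] closed
      U.cohomology_ops V.cohomology_ops W.cohomology_ops
        U.hom_add U.hom_scale U.linear.add U.linear.scale V.linear.add V.linear.scale
        left.add right.add left.scale right.scale W.gcomp_cohomologyI degree)

end

section \<open>Low-order values of linear extensions\<close>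

lemma cl_ext_Nil: "cl_ext g p T \<beta> [] = T (\<beta> []) []"
  by (simp add: cl_ext_def)

lemma cl_ext_single:
  assumes g: "fd_graded_space g" and x: "x \<in> hom g i" "x \<noteq> 0"
  shows "cl_ext g p T \<beta> [x] = T (\<beta> []) [x] + sgnpow (p * (i - 1)) (T (\<beta> [x]) [])"
proof -
  have t: "tagged g [(i, x)]" using x by (simp add: tagged_def)
  have P: "Pow {..<Suc 0} = {{}, {0}}" by auto
  show ?thesis
    using cl_ext_tagged[OF g t, of p T \<beta>] by (simp add: P koszul_Cons nths_Cons)
qed

text \<open>The four terms belong to the subsets of the two positions. For the subset {1} the Koszul
  sign of the swap cancels the sign of moving the form part of \<open>T\<close> past the argument of
  \<open>\<beta>\<close>; for {0} only the latter sign occurs.\<close>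

lemma cl_ext_pair:
  assumes g: "fd_graded_space g" and x: "x \<in> hom g i" "x \<noteq> 0" and y: "y \<in> hom g j" "y \<noteq> 0"
  shows "cl_ext g p T \<beta> [x, y] = T (\<beta> []) [x, y]
    + sgnpow ((i - 1) * (j - 1) + p * (i - 1)) (T (\<beta> [x]) [y])
    + sgnpow (p * (j - 1)) (T (\<beta> [y]) [x])
    + sgnpow (p * (i + j)) (T (\<beta> [x, y]) [])"
proof -
  have t: "tagged g [(i, x), (j, y)]" using x y by (simp add: tagged_def)
  have P: "Pow {..<Suc (Suc 0)} = {{}, {0}, {1}, {0, 1}}" by (auto simp: less_Suc_eq)
  have 1: "sgnpow (p * (i - 1 + (j - 1))) v = sgnpow (p * (i + j)) v" for v :: 'd
    by (intro sgnpow_even) (simp add: algebra_simps)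
  have 2: "sgnpow ((i - 1) * (j - 1) + (i - 1) * (j - 1) + p * (j - 1)) v = sgnpow (p * (j - 1)) v"
    for v :: 'd
    by (intro sgnpow_even) simp
  show ?thesis
    using cl_ext_tagged[OF g t, of p T \<beta>] 1 2
    by (simp add: P koszul_Cons nths_Cons add.assoc mult.commute)
qed

text \<open>The cochain \<open>incl0 m\<close> lives on the empty list, so only the summand with
  \<open>S\<close> empty survives, and its sign is trivial.\<close>

lemma cl_ext_incl0:
  assumes g: "fd_graded_space g" and T: "\<And>xs. T 0 xs = 0" and ts: "tagged g ts"
  shows "cl_ext g p T (incl0 m) (map snd ts) = T m (map snd ts)"
proof -
  \<comment> \<open>A nonempty set of valid positions selects at least one argument, on which
    \<open>incl0 m\<close> vanishes.\<close>
  have "nths ts S \<noteq> []" if S: "S \<subseteq> {..<length ts}" "S \<noteq> {}" for S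
  proof -
    obtain q where "q \<in> S" "q < length ts" using S by auto
    then have "ts ! q \<in> set (nths ts S)" unfolding set_nths by auto
    then show ?thesis by auto
  qed
  then have "sgnpow n (T (incl0 m (map snd (nths ts S))) ys) = 0"
    if "S \<in> Pow {..<length ts} - {{}}" for S n ys
    using that T by (simp add: incl0_def)
  then have "cl_ext g p T (incl0 m) (map snd ts) =
      sgnpow (koszul ts {}) (T m (map snd (nths ts (- {}))))"
    unfolding cl_ext_tagged[OF g ts]
    by (subst sum.remove[of _ "{}"]) (auto simp: incl0_def)
  then show ?thesis by (simp add: koszul_def nths_all)
qed

section \<open>Contractions and the Chevalley-Eilenberg differential in low order\<close>

lemma component_zero:
  assumes "fd_graded_space g"
  shows "component g i 0 = 0"
proof -
  have "decomposition g 0 (\<lambda>i. 0)"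
    using assms module.subspace_0[of "scl g"]
    unfolding decomposition_def fd_graded_space_def vector_space_def module_def by simp
  then show ?thesis using component_eqI[OF assms] by fastforce
qed

lemma contract_zero: "fd_graded_space g \<Longrightarrow> contract g 0 \<mu> ys = 0"
  by (simp add: contract_def component_zero)

text \<open>Contraction evaluates its cochain only on lists of nonzero homogeneous entries, so
  formulas known on tagged lists suffice.\<close>

lemma contract_cong:
  assumes "fd_graded_space g"
    and "\<And>ts. tagged g ts \<Longrightarrow> length ts = Suc (length ys) \<Longrightarrow> \<mu> (map snd ts) = \<nu> (map snd ts)"
  shows "contract g x \<mu> ys = contract g x \<nu> ys"
  unfolding contract_def by (rule hom_ext_cong[OF assms(1)]) (simp add: assms(2))

lemma CE_diff_Nil: "fd_graded_space g \<Longrightarrow> CE_diff g \<mu> [] = 0"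
  by (simp add: CE_diff_def CE_diff0_def CE_diff1_def contract_by_def cl_ext_Nil
      CE_field0_def CE_field1_def contract_zero)

lemma CE_field1_eq_0 [simp]: "CE_field1 g [] = 0" "CE_field1 g [z] = 0"
  by (simp_all add: CE_field1_def)

lemma CE_diff_single:
  assumes "fd_graded_space g" "x \<in> hom g i" "x \<noteq> 0"
  shows "CE_diff g \<mu> [x] = contract g (- dif g x) \<mu> []"
  by (simp add: CE_diff_def CE_diff0_def CE_diff1_def contract_by_def cl_ext_single[OF assms]
      CE_field0_def contract_zero[OF assms(1)])

text \<open>On cocycles \<open>x\<close> and \<open>y\<close> the field of \<open>d\<^sub>0\<close>
  vanishes, and the field of \<open>d\<^sub>1\<close> needs both arguments; what remains is
  contraction with the bracket.\<close>

lemma CE_diff_pair: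
  assumes "fd_graded_space g" "x \<in> hom g i" "x \<noteq> 0" "y \<in> hom g j" "y \<noteq> 0"
    and "dif g x = 0" "dif g y = 0"
  shows "CE_diff g \<mu> [x, y] = contract g (sgnpow i (brk g x y)) \<mu> []"
proof -
  have "tagged g [(i, x), (j, y)]" using assms by (simp add: tagged_def)
  then have "hom_ext g F [x, y] = F [(i, x), (j, y)]" for F :: "(int \<times> 'b) list \<Rightarrow> 'b"
    using hom_ext_tagged[OF assms(1), of _ F] by fastforce
  then have "CE_field1 g [x, y] = sgnpow i (brk g x y)"
    by (simp add: CE_field1_def del: hom_ext.simps)
  then show ?thesis
    by (simp add: CE_diff_def CE_diff0_def CE_diff1_def contract_by_def cl_ext_pair[OF assms(1-5)]
      CE_field0_def contract_zero[OF assms(1)] assms)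
qed

text \<open>Contraction evaluates on one more argument and therefore kills cochains without
  arguments.\<close>

lemma CE_diff_incl0:
  assumes g: "fd_graded_space g" and ts: "tagged g ts"
  shows "CE_diff g (incl0 m) (map snd ts) = 0"
proof -
  have "contract g x (incl0 m) ys = 0" for x ys
  proof -
    have "contract g x (incl0 m) ys = contract g x (\<lambda>_. 0) ys"
      by (rule contract_cong[OF g]) (auto simp: incl0_def)
    then show ?thesis by (simp add: contract_def hom_ext_zero del: hom_ext.simps)
  qed
  then show ?thesis
    by (simp add: CE_diff_def CE_diff0_def CE_diff1_def contract_by_def cl_ext_tagged[OF g ts])
qed

section \<open>Operations of modules and morphisms up to homotopy\<close>

declare One_nat_def [simp del]

text \<open>The index set may exceed the support, since components can cancel when decompositions
  are added.\<close>

lemma decompositionI: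
  assumes "\<And>i. c i \<in> hom V i" "finite A" "{i. c i \<noteq> 0} \<subseteq> A" "v = sum c A"
  shows "decomposition V v c"
proof -
  have "sum c {i. c i \<noteq> 0} = sum c A"
    using assms by (intro sum.mono_neutral_left) auto
  then show ?thesis
    using assms finite_subset by (auto simp: decomposition_def)
qed

lemma linear_component:
  assumes V: "fd_graded_space V"
  shows "Vector_Spaces.linear (scl V) (scl V) (component V i)"
proof -
  interpret vector_space "scl V" using V by (simp add: fd_graded_space_def)
  have sub: "subspace (hom V i)" for i using V by (simp add: fd_graded_space_def)
  let ?S = "\<lambda>v. {i. component V i v \<noteq> 0}"
  note d = component_decomposition[OF V, unfolded decomposition_def]
  have "component V i (x + y) = component V i x + component V i y" for x y
  proof (rule component_eqI[OF V], rule decompositionI)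
    show "finite (?S x \<union> ?S y)" using d by auto
    have "sum (\<lambda>i. component V i x) (?S x \<union> ?S y) = x" "sum (\<lambda>i. component V i y) (?S x \<union> ?S y) = y"
      using d by (auto simp: sum.mono_neutral_left[of "?S x \<union> ?S y" "?S x", symmetric]
          sum.mono_neutral_left[of "?S x \<union> ?S y" "?S y", symmetric])
    then show "x + y = (\<Sum>i\<in>?S x \<union> ?S y. component V i x + component V i y)"
      by (simp add: sum.distrib)
  qed (use d subspace_add[OF sub] in auto)
  moreover have "component V i (scl V c x) = scl V c (component V i x)" for c x
  proof (rule component_eqI[OF V], rule decompositionI)
    show "scl V c x = (\<Sum>i\<in>?S x. scl V c (component V i x))"
      using d by (simp add: scale_sum_right[symmetric])
  qed (use d subspace_scale[OF sub] in auto)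
  ultimately show ?thesis
    by (simp add: Vector_Spaces.linear_iff vector_space_axioms)
qed

lemma contract_Nil:
  "contract g x \<mu> [] =
    (\<Sum>i | component g i x \<noteq> 0. sgnpow ((i - 1) * (i - 1)) (\<mu> [component g i x]))"
  by (simp add: contract_def)

lemma linear_contract_Nil:
  assumes g: "fd_graded_space g"
    and lin: "Vector_Spaces.linear (scl g) (scl W) (\<lambda>x. \<mu> [x])"
  shows "Vector_Spaces.linear (scl g) (scl W) (\<lambda>x. contract g x \<mu> [])"
proof -
  interpret L: Vector_Spaces.linear "scl g" "scl W" "\<lambda>x. \<mu> [x]" by (rule lin)
  interpret C: Vector_Spaces.linear "scl g" "scl g" "component g i" for i
    by (rule linear_component[OF g])
  have fin: "finite {i. component g i x \<noteq> 0}" for x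
    using component_decomposition[OF g, of x] by (simp add: decomposition_def)
  \<comment> \<open>The range of summation depends on \<open>x\<close>. Enlarging it to a common
    finite set lets the sums for \<open>x\<close>, \<open>y\<close> and \<open>x + y\<close> be
    compared termwise.\<close>
  have eq: "contract g x \<mu> [] = (\<Sum>i\<in>A. sgnpow ((i - 1) * (i - 1)) (\<mu> [component g i x]))"
    if "finite A" "{i. component g i x \<noteq> 0} \<subseteq> A" for x A
    unfolding contract_Nil using that by (intro sum.mono_neutral_left) (auto simp: L.zero)
  have "contract g (x + y) \<mu> [] = contract g x \<mu> [] + contract g y \<mu> []" for x y
  proof -
    let ?A = "{i. component g i x \<noteq> 0} \<union> {i. component g i y \<noteq> 0}"
    have "finite ?A" using fin by blast
    then show ?thesis
      by (subst (1 2 3) eq[where A = ?A])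
        (auto simp: C.add L.add sgnpow_def sum.distrib[symmetric] intro!: sum.cong)
  qed
  moreover have "contract g (scl g c x) \<mu> [] = scl W c (contract g x \<mu> [])" for c x
    by (subst (1 2) eq[where A = "{i. component g i x \<noteq> 0}"])
      (auto simp: fin C.scale L.scale sgnpow_def L.vs2.scale_sum_right intro!: sum.cong)
  ultimately show ?thesis
    by (simp add: Vector_Spaces.linear_iff L.vs1.vector_space_axioms L.vs2.vector_space_axioms)
qed

text \<open>The square of \<open>i - 1\<close> has the parity of \<open>i - 1\<close>. The
  assumption on \<open>\<mu> [0]\<close> covers \<open>x = 0\<close>, where the contraction is an
  empty sum.\<close>

lemma contract_Nil_homogeneous:
  assumes "fd_graded_space g" "x \<in> hom g i" "\<mu> [0] = 0"
  shows "contract g x \<mu> [] = sgnpow (i - 1) (\<mu> [x])"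
  using assms(3) by (auto simp: contract_homogeneous[OF assms(1,2)] sgnpow_def)

lemma incl0_cochain:
  assumes "vector_space (scl g)" "vector_space (scl W)"
  shows "incl0 w \<in> cochains g W"
proof -
  interpret W: vector_space "scl W" by fact
  have "Vector_Spaces.linear (scl g) (scl W) (\<lambda>x. 0)"
    using assms by (simp add: Vector_Spaces.linear_iff)
  then show ?thesis by (auto simp: cochains_def incl0_def)
qed

context
  fixes g :: "('k::field, 'g::ab_group_add, 'x) gspace_scheme"
    and V :: "('k, 'v::ab_group_add, 'y) gspace_scheme"
    and W :: "('k, 'w::ab_group_add, 'z) gspace_scheme"
    and T p
  assumes T: "locally_finite_family g V W p T"
begin

lemma family_linear: "Vector_Spaces.linear (scl V) (scl W) (\<lambda>m. T k m xs)"
  using T by (simp add: locally_finite_family_def)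

lemma family_zero: "T k 0 xs = 0"
proof -
  interpret Vector_Spaces.linear "scl V" "scl W" "\<lambda>m. T k m xs" by (rule family_linear)
  show ?thesis by (rule zero)
qed

lemma family_sgnpow: "T k (sgnpow n m) xs = sgnpow n (T k m xs)"
proof -
  interpret Vector_Spaces.linear "scl V" "scl W" "\<lambda>m. T k m xs" by (rule family_linear)
  show ?thesis by (simp add: sgnpow_def neg)
qed

lemma family_linear_single: "Vector_Spaces.linear (scl g) (scl W) (\<lambda>x. T k m [x])"
proof -
  have "T k m \<in> cochains g W"
    using T by (simp add: locally_finite_family_def cochains_of_length_def)
  then have "Vector_Spaces.linear (scl g) (scl W) (\<lambda>x. T k m ([] @ x # []))"
    unfolding cochains_def by blast
  then show ?thesis by simp
qed

lemma family_arg_zero: "T k m [0] = 0"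
proof -
  interpret Vector_Spaces.linear "scl g" "scl W" "\<lambda>x. T k m [x]" by (rule family_linear_single)
  show ?thesis by (rule zero)
qed

lemma family_length: "length xs \<noteq> k \<Longrightarrow> T k m xs = 0"
  using T by (simp add: locally_finite_family_def cochains_of_length_def)

lemma family_degree:
  assumes "m \<in> hom V i" "\<forall>(j, x) \<in> set ts. x \<in> hom g j"
  shows "T k m (map snd ts) \<in> hom W (i + p + sdeg ts)"
  using T assms by (auto simp: locally_finite_family_def has_total_degree_def)

lemma family_sum_eq: "family_sum T m xs = T (length xs) m xs"
  unfolding family_sum_def using family_length
  by (subst sum.remove[of _ "length xs"]) (auto intro!: sum.neutral)

lemma cl_ext_family_incl0:
  assumes "fd_graded_space g" "tagged g ts"
  shows "cl_ext g q (family_sum T) (incl0 m) (map snd ts) = T (length ts) m (map snd ts)"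
  using cl_ext_incl0[of g "family_sum T" ts q m] assms by (simp add: family_sum_eq family_zero)

end

section \<open>The square-zero condition of a module evaluated on few arguments\<close>

locale dgla_module =
  fixes g :: "('k::field, 'g::ab_group_add) dgla"
    and M :: "('k, 'g, 'm::ab_group_add) inf_mod"
  assumes Lie: "dg_Lie_algebra g" and module: "inf_module g M"
begin

abbreviation act :: "'g \<Rightarrow> 'm \<Rightarrow> 'm" where
  "act x m \<equiv> Pr (contract g x (mop M 1 m))"

lemma g_fd: "fd_graded_space g" and M_fd: "fd_graded_space M"
  and ops: "locally_finite_family g M M 1 (mop M)"
  using Lie module by (simp_all add: dg_Lie_algebra_def inf_module_def)

lemma g_vs: "vector_space (scl g)" and M_vs: "vector_space (scl M)"
  using g_fd M_fd by (simp_all add: fd_graded_space_def)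

lemmas op_simps = family_zero[OF ops] family_sgnpow[OF ops] family_arg_zero[OF ops]
  family_sum_eq[OF ops]

lemma act_homogeneous: "x \<in> hom g i \<Longrightarrow> mop M 1 m [x] = sgnpow (i - 1) (act x m)"
  using contract_Nil_homogeneous[OF g_fd, of x i "mop M 1 m"] by (simp add: Pr_def op_simps)

text \<open>As \<open>d\<^sub>C\<^sub>E\<close> kills constants, the total differential of 1 tensor
  \<open>m\<close> is the sum of all \<open>d\<^sub>k m\<close>, and the number of arguments selects
  \<open>k\<close>.\<close>

lemma d_tot_incl0:
  assumes "tagged g ts"
  shows "d_tot g M (incl0 m) (map snd ts) = mop M (length ts) m (map snd ts)"
  using assms by (simp add: d_tot_def CE_diff_incl0[OF g_fd] cl_ext_family_incl0[OF ops g_fd])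

lemma d_tot_incl0_simps:
  "d_tot g M (incl0 m) [] = mod_diff M m"
  "x \<in> hom g i \<Longrightarrow> x \<noteq> 0 \<Longrightarrow> d_tot g M (incl0 m) [x] = sgnpow (i - 1) (act x m)"
  "contract g x (d_tot g M (incl0 m)) [] = act x m"
proof -
  show "d_tot g M (incl0 m) [] = mod_diff M m"
    using d_tot_incl0[of "[]" m] by (simp add: tagged_def mod_diff_def Pr_def)
  show "d_tot g M (incl0 m) [x] = sgnpow (i - 1) (act x m)" if "x \<in> hom g i" "x \<noteq> 0"
    using d_tot_incl0[of "[(i, x)]" m] that by (simp add: tagged_def act_homogeneous flip: One_nat_def)
  show "contract g x (d_tot g M (incl0 m)) [] = act x m"
    unfolding Pr_def by (rule contract_cong[OF g_fd]) (simp add: d_tot_incl0 flip: One_nat_def)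
qed

lemma d_tot_square: "d_tot g M (d_tot g M (incl0 m)) xs = 0"
  using module incl0_cochain[OF g_vs M_vs] by (simp add: inf_module_def)

lemma mod_diff_square: "mod_diff M (mod_diff M m) = 0"
  using d_tot_square[of m "[]"]
  by (simp add: d_tot_def[of _ _ "d_tot g M (incl0 m)"] CE_diff_Nil[OF g_fd] cl_ext_Nil
      d_tot_incl0_simps op_simps) (simp add: mod_diff_def Pr_def)

lemma act_linear_left: "Vector_Spaces.linear (scl g) (scl M) (\<lambda>x. act x m)"
  unfolding Pr_def by (rule linear_contract_Nil[OF g_fd family_linear_single[OF ops]])

sublocale act_left: Vector_Spaces.linear "scl g" "scl M" "\<lambda>x. act x m" for m
  by (rule act_linear_left)

lemma act_left_sgnpow: "act (sgnpow n x) m = sgnpow n (act x m)"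
  by (simp add: sgnpow_def act_left.neg)

lemma act_linear_right: "Vector_Spaces.linear (scl M) (scl M) (act x)"
proof -
  interpret L: Vector_Spaces.linear "scl M" "scl M" "\<lambda>m. mop M k m xs" for k xs
    by (rule family_linear[OF ops])
  show ?thesis
    by (auto simp: Pr_def contract_Nil Vector_Spaces.linear_iff M_vs L.add L.scale sgnpow_def
        act_left.vs2.scale_sum_right
        sum.distrib[symmetric] intro!: sum.cong)
qed

sublocale act_right: Vector_Spaces.linear "scl M" "scl M" "act x" for x
  by (rule act_linear_right)

sublocale g: cochain_complex g "dif g"
proof (rule cochain_complex.intro)
  show "fd_graded_space g" by (rule g_fd)
qed (use Lie in \<open>unfold dg_Lie_algebra_def, (elim conjE, blast)+\<close>)

sublocale M: cochain_complex M "mod_diff M"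
proof (rule cochain_complex.intro)
  show "fd_graded_space M" by (rule M_fd)
  show "Vector_Spaces.linear (scl M) (scl M) (mod_diff M)"
    unfolding mod_diff_def Pr_def by (rule family_linear[OF ops])
  show "mod_diff M m \<in> hom M (i + 1)" if "m \<in> hom M i" for m i
    using family_degree[OF ops that, of "[]" 0] by (simp add: mod_diff_def Pr_def)
qed (rule mod_diff_square)

text \<open>The operation \<open>d\<^sub>1\<close> raises the degree by 1 and inserting
  \<open>x[1]\<close> adds \<open>i - 1\<close>, which gives \<open>i + j\<close> in total.\<close>

lemma act_degree:
  assumes "x \<in> hom g i" "m \<in> hom M j"
  shows "act x m \<in> hom M (i + j)"
proof -
  have "sgnpow (i - 1) (act x m) \<in> hom M (j + 1 + (i - 1))"
    using family_degree[OF ops assms(2), of "[(i, x)]" 1] assms(1)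
    by (simp add: act_homogeneous flip: One_nat_def)
  from M.hom_sgnpow[OF this, of "i - 1"] show ?thesis by (simp add: algebra_simps)
qed

lemma mod_diff_act:
  assumes x: "x \<in> hom g i"
  shows "mod_diff M (act x m) = act (dif g x) m + sgnpow i (act x (mod_diff M m))"
proof (cases "x = 0")
  case True
  then show ?thesis by (simp add: act_left.zero M.linear.zero g.linear.zero)
next
  case False
  \<comment> \<open>On the left stand \<open>d\<^sub>1\<close> after \<open>d\<^sub>0\<close> and
    \<open>d\<^sub>0\<close> after \<open>d\<^sub>1\<close>, in the latter two equal signs
    cancelling. The right side is the Chevalley-Eilenberg term, moved across the equation.\<close>
  have "sgnpow (i - 1) (act x (mod_diff M m)) + mod_diff M (act x m) = act (dif g x) m"
    using d_tot_square[of m "[x]"] x False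
    by (simp add: d_tot_def[of _ _ "d_tot g M (incl0 m)"] CE_diff_single[OF g_fd]
        cl_ext_single[OF g_fd] d_tot_incl0_simps op_simps act_left.neg act_homogeneous flip: One_nat_def)
      (simp add: mod_diff_def Pr_def eq_neg_iff_add_eq_0[symmetric])
  then show ?thesis by (auto simp: sgnpow_def algebra_simps)
qed

lemma linear_bracket:
  "Vector_Spaces.linear (scl g) (scl g) (brk g x)"
  "Vector_Spaces.linear (scl g) (scl g) (\<lambda>x. brk g x y)"
  using Lie by (simp_all add: dg_Lie_algebra_def)

sublocale brk_left: Vector_Spaces.linear "scl g" "scl g" "\<lambda>x. brk g x y" for y
  by (rule linear_bracket)

sublocale brk_right: Vector_Spaces.linear "scl g" "scl g" "brk g x" for x
  by (rule linear_bracket)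

text \<open>The operation \<open>d\<^sub>2\<close> is the homotopy for the Lie action. Its composite
  with \<open>d\<^sub>0\<close> in the other order, \<open>d\<^sub>2\<close> of
  \<open>d\<^sub>0 m\<close>, drops out because \<open>m\<close> is closed.\<close>

lemma act_bracket:
  assumes x: "x \<in> hom g i" "dif g x = 0" and y: "y \<in> hom g j" "dif g y = 0"
    and m: "mod_diff M m = 0"
  obtains n where "act (brk g x y) m = act x (act y m) - sgnpow (i * j) (act y (act x m)) + mod_diff M n"
proof -
  let ?\<nu> = "d_tot g M (incl0 m)" and ?n = "mop M 2 m [x, y]"
  show thesis
  proof (cases "x = 0 \<or> y = 0")
    case True
    then have "brk g x y = 0" by (auto simp: brk_left.zero brk_right.zero)
    then show ?thesis
      using True that[of 0] by (auto simp: act_left.zero act_right.zero M.linear.zero)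
  next
    case False
    then have "?\<nu> [x, y] = ?n"
      using d_tot_incl0[of "[(i, x), (j, y)]" m] x y by (simp add: tagged_def numeral_2_eq_2)
    \<comment> \<open>The Chevalley-Eilenberg term comes first; the other terms belong to the
      nonempty subsets in \<open>cl_ext_pair\<close>: first \<open>x\<close> and then
      \<open>y\<close> acts, first \<open>y\<close> and then \<open>x\<close>, and
      \<open>d\<^sub>0\<close> after \<open>d\<^sub>2\<close>.\<close>
    then have "sgnpow i (act (brk g x y) m)
        + (sgnpow ((i - 1) * (j - 1) + (i - 1)) (sgnpow (i - 1 + (j - 1)) (act y (act x m)))
        + sgnpow (j - 1) (sgnpow (i - 1 + (j - 1)) (act x (act y m)))
        + sgnpow (i + j) (mod_diff M ?n)) = 0"
      using d_tot_square[of m "[x, y]"] x y False m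
      by (simp add: d_tot_def[of _ _ ?\<nu>] CE_diff_pair[OF g_fd x(1) _ y(1)] d_tot_incl0_simps
          cl_ext_pair[OF g_fd x(1) _ y(1)] op_simps act_left_sgnpow act_homogeneous
          add.commute flip: One_nat_def)
        (simp add: mod_diff_def Pr_def)
    \<comment> \<open>Solving for the bracket term multiplies the exact term by minus the signs of
      \<open>i\<close> and \<open>i + j\<close>, hence \<open>j + 1\<close>.\<close>
    then have "act (brk g x y) m = act x (act y m) - sgnpow (i * j) (act y (act x m))
        + mod_diff M (sgnpow (j + 1) ?n)"
      by (auto simp: sgnpow_def algebra_simps M.linear.neg split: if_splits)
    then show ?thesis by (rule that)
  qed
qed

section \<open>The induced bracket and action on tangent cohomology\<close>

lemma bracket_bilinear: "graded_bilinear (as_gvec g) (as_gvec g) (as_gvec g) (brk g)"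
  using Lie unfolding dg_Lie_algebra_def graded_Lie_algebra_def by (elim conjE)

lemma bracket_antisymmetric:
  "\<forall>i j. \<forall>x\<in>hom g i. \<forall>y\<in>hom g j. brk g x y = scl g (- ((-1) powi (i * j))) (brk g y x)"
  using Lie unfolding dg_Lie_algebra_def graded_Lie_algebra_def as_gvec_def gvec.select_convs
  by (elim conjE)

lemma bracket_Jacobi:
  "\<forall>i j k. \<forall>x\<in>hom g i. \<forall>y\<in>hom g j. \<forall>z\<in>hom g k. brk g x (brk g y z) =
    brk g (brk g x y) z + scl g ((-1) powi (i * j)) (brk g y (brk g x z))"
  using Lie unfolding dg_Lie_algebra_def graded_Lie_algebra_def as_gvec_def gvec.select_convs
  by (elim conjE)

lemma bracket_derivation:
  "\<forall>i. \<forall>x\<in>hom g i. \<forall>y. dif g (brk g x y) = brk g (dif g x) y + sgnpow i (brk g x (dif g y))"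
  using Lie unfolding dg_Lie_algebra_def by (elim conjE)

lemma bracket_degree:
  assumes "x \<in> hom g i" "y \<in> hom g j"
  shows "brk g x y \<in> hom g (i + j)"
proof -
  have "\<forall>i j. \<forall>x\<in>gcomp (as_gvec g) i. \<forall>y\<in>gcomp (as_gvec g) j. brk g x y \<in> gcomp (as_gvec g) (i + j)"
    using bracket_bilinear unfolding graded_bilinear_def by blast
  then show ?thesis using assms by (simp add: as_gvec_def)
qed

sublocale bracket: chain_pairing g "dif g" g "dif g" g "dif g" "brk g"
proof (intro chain_pairing.intro chain_pairing_axioms.intro g.cochain_complex_axioms
    linear_bracket bracket_degree)
  show "dif g (brk g x y) = brk g (dif g x) y + sgnpow i (brk g x (dif g y))"
    if "x \<in> hom g i" for x i y
    using bracket_derivation that by blast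
qed

sublocale action: chain_pairing g "dif g" M "mod_diff M" M "mod_diff M" act
  by (intro chain_pairing.intro chain_pairing_axioms.intro g.cochain_complex_axioms
      M.cochain_complex_axioms act_linear_left act_linear_right act_degree mod_diff_act)

lemma tan_bracket_cls:
  "x \<in> hom g i \<Longrightarrow> dif g x = 0 \<Longrightarrow> dif g y = 0 \<Longrightarrow>
    tan_bracket g (cls (dif g) x) (cls (dif g) y) = cls (dif g) (brk g x y)"
  unfolding tan_bracket_def by (rule bracket.lift_cls2_eq)

lemma tan_action_cls:
  "x \<in> hom g i \<Longrightarrow> dif g x = 0 \<Longrightarrow> mod_diff M m = 0 \<Longrightarrow>
    tan_action g M (cls (dif g) x) (cls (mod_diff M) m) = cls (mod_diff M) (act x m)"
  unfolding tan_action_def by (rule action.lift_cls2_eq)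

text \<open>Antisymmetry and the Jacobi identity hold for representatives already; brackets of
  cocycles are cocycles, so iterated brackets of classes are computed on representatives.\<close>

lemma graded_Lie_algebra_tangent: "graded_Lie_algebra (H_tan_Lie g) (tan_bracket g)"
  unfolding graded_Lie_algebra_def
proof (intro conjI allI ballI)
  show "graded_vector_space (H_tan_Lie g)"
    unfolding H_tan_Lie_def by (rule g.graded_vector_space_cohomology)
  show "graded_bilinear (H_tan_Lie g) (H_tan_Lie g) (H_tan_Lie g) (tan_bracket g)"
    unfolding H_tan_Lie_def tan_bracket_def by (rule bracket.graded_bilinear_cohomology)
next
  fix i j X Y assume "X \<in> gcomp (H_tan_Lie g) i" "Y \<in> gcomp (H_tan_Lie g) j"
  then obtain x y where x: "x \<in> hom g i" "dif g x = 0" and X: "X = cls (dif g) x"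
    and y: "y \<in> hom g j" "dif g y = 0" and Y: "Y = cls (dif g) y"
    unfolding H_tan_Lie_def by (elim g.gcomp_cohomologyE) blast
  show "tan_bracket g X Y = gsmult (H_tan_Lie g) (- ((-1) powi (i * j))) (tan_bracket g Y X)"
    unfolding X Y tan_bracket_cls[OF x y(2)] tan_bracket_cls[OF y x(2)] H_tan_Lie_def g.gsmult_cls
    by (rule arg_cong[OF bracket_antisymmetric[rule_format, OF x(1) y(1)]])
next
  fix i j k X Y Z
  assume "X \<in> gcomp (H_tan_Lie g) i" "Y \<in> gcomp (H_tan_Lie g) j" "Z \<in> gcomp (H_tan_Lie g) k"
  then obtain x y z where x: "x \<in> hom g i" "dif g x = 0" and X: "X = cls (dif g) x"
    and y: "y \<in> hom g j" "dif g y = 0" and Y: "Y = cls (dif g) y"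
    and z: "z \<in> hom g k" "dif g z = 0" and Z: "Z = cls (dif g) z"
    unfolding H_tan_Lie_def by (elim g.gcomp_cohomologyE) blast
  show "tan_bracket g X (tan_bracket g Y Z) = gadd (H_tan_Lie g) (tan_bracket g (tan_bracket g X Y) Z)
      (gsmult (H_tan_Lie g) ((-1) powi (i * j)) (tan_bracket g Y (tan_bracket g X Z)))"
  proof -
    have c: "dif g (brk g a b) = 0" if "a \<in> hom g n" "dif g a = 0" "dif g b = 0" for a b n
      using that by (rule bracket.closed)
    show ?thesis
      unfolding X Y Z tan_bracket_cls[OF y z(2)] tan_bracket_cls[OF x z(2)] tan_bracket_cls[OF x y(2)]
        tan_bracket_cls[OF x c[OF y z(2)]] tan_bracket_cls[OF y c[OF x z(2)]]
        tan_bracket_cls[OF bracket_degree[OF x(1) y(1)] c[OF x y(2)] z(2)]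
        H_tan_Lie_def g.cohomology_ops bracket_Jacobi[rule_format, OF x(1) y(1) z(1)] ..
  qed
qed

text \<open>Unlike the Jacobi identity, the module identity holds for representatives only up to the
  exact term of \<open>act_bracket\<close>, which the class absorbs.\<close>

lemma graded_Lie_module_tangent:
  "graded_Lie_module (H_tan_Lie g) (tan_bracket g) (H_tan_mod M) (tan_action g M)"
  unfolding graded_Lie_module_def
proof (intro conjI allI ballI)
  show "graded_vector_space (H_tan_mod M)"
    unfolding H_tan_mod_def by (rule M.graded_vector_space_cohomology)
  show "graded_bilinear (H_tan_Lie g) (H_tan_mod M) (H_tan_mod M) (tan_action g M)"
    unfolding H_tan_Lie_def H_tan_mod_def tan_action_def by (rule action.graded_bilinear_cohomology)
next
  fix i j k X Y U
  assume "X \<in> gcomp (H_tan_Lie g) i" "Y \<in> gcomp (H_tan_Lie g) j" "U \<in> gcomp (H_tan_mod M) k"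
  then obtain x y m where x: "x \<in> hom g i" "dif g x = 0" and X: "X = cls (dif g) x"
    and y: "y \<in> hom g j" "dif g y = 0" and Y: "Y = cls (dif g) y"
    and m: "m \<in> hom M k" "mod_diff M m = 0" and U: "U = cls (mod_diff M) m"
    unfolding H_tan_Lie_def H_tan_mod_def by (elim g.gcomp_cohomologyE M.gcomp_cohomologyE) blast
  obtain n where n: "act (brk g x y) m =
      act x (act y m) - sgnpow (i * j) (act y (act x m)) + mod_diff M n"
    using act_bracket[OF x y m(2)] .
  have "cls (mod_diff M) (act (brk g x y) m) =
      cls (mod_diff M) (act x (act y m) - sgnpow (i * j) (act y (act x m)))"
    unfolding n by (rule M.cls_add)
  then show "tan_action g M (tan_bracket g X Y) U = gadd (H_tan_mod M)
      (tan_action g M X (tan_action g M Y U))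
      (gsmult (H_tan_mod M) (- ((-1) powi (i * j))) (tan_action g M Y (tan_action g M X U)))"
    unfolding X Y U tan_bracket_cls[OF x y(2)] tan_action_cls[OF x m(2)] tan_action_cls[OF y m(2)]
      tan_action_cls[OF x action.closed[OF y m(2)]] tan_action_cls[OF y action.closed[OF x m(2)]]
      tan_action_cls[OF bracket_degree[OF x(1) y(1)] bracket.closed[OF x y(2)] m(2)]
      H_tan_mod_def M.cohomology_ops scl_minus_powi[OF M_vs]
    by simp
qed

end

lemma d_tot_adjoint:
  "d_tot g (adjoint g) \<eta> xs = CE_diff g \<eta> xs + cl_ext g 1 (family_sum (adjoint_op g)) \<eta> xs"
  by (simp add: d_tot_def adjoint_def)

section \<open>The morphism equation evaluated on few arguments\<close>

locale dgla_module_morphism = dgla_module g M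
  for g :: "('k::field, 'g::ab_group_add) dgla"
    and M :: "('k, 'g, 'm::ab_group_add) inf_mod" +
  fixes f :: "nat \<Rightarrow> 'm \<Rightarrow> 'g list \<Rightarrow> 'g"
  assumes morphism: "inf_morphism g M (adjoint g) f"
begin

abbreviation f0 :: "'m \<Rightarrow> 'g" where
  "f0 m \<equiv> Pr (f 0 m)"

text \<open>The adjoint module has the scalars and the grading of \<open>g\<close>, so only the
  record changes.\<close>

lemma family: "locally_finite_family g M g 0 f"
proof -
  have "locally_finite_family g M (adjoint g) 0 f"
    using morphism by (simp add: inf_morphism_def)
  then show ?thesis
    unfolding locally_finite_family_def cochains_of_length_def cochains_def
      has_total_degree_def adjoint_def gspace.select_convs .
qed

lemma f0_linear: "Vector_Spaces.linear (scl M) (scl g) f0"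
  unfolding Pr_def by (rule family_linear[OF family])

sublocale f0: Vector_Spaces.linear "scl M" "scl g" f0
  by (rule f0_linear)

lemma f0_degree: "m \<in> hom M i \<Longrightarrow> f0 m \<in> hom g i"
  using family_degree[OF family, of m i "[]" 0] by (simp add: Pr_def)

lemma commutes_incl0:
  "cl_ext g 0 (family_sum f) (d_tot g M (incl0 m)) xs =
    d_tot g (adjoint g) (cl_ext g 0 (family_sum f) (incl0 m)) xs"
proof -
  have "\<forall>\<mu>\<in>cochains g M.
      cl_ext g 0 (family_sum f) (d_tot g M \<mu>) = d_tot g (adjoint g) (cl_ext g 0 (family_sum f) \<mu>)"
    using morphism unfolding inf_morphism_def by (elim conjE)
  from bspec[OF this incl0_cochain[OF g_vs M_vs]] show ?thesis by (rule fun_cong)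
qed

lemma ext_incl0:
  "cl_ext g 0 (family_sum f) (incl0 m) [] = f0 m"
  "x \<in> hom g i \<Longrightarrow> x \<noteq> 0 \<Longrightarrow> cl_ext g 0 (family_sum f) (incl0 m) [x] = f 1 m [x]"
  using cl_ext_family_incl0[OF family g_fd, of "[]" 0 m]
    cl_ext_family_incl0[OF family g_fd, of "[(i, x)]" 0 m]
  by (simp_all add: tagged_def Pr_def flip: One_nat_def)

lemma family_sum_adjoint:
  "family_sum (adjoint_op g) y [] = dif g y"
  "x \<in> hom g i \<Longrightarrow> x \<noteq> 0 \<Longrightarrow> family_sum (adjoint_op g) y [x] = sgnpow (i - 1) (brk g x y)"
proof -
  show "family_sum (adjoint_op g) y [] = dif g y"
    by (simp add: family_sum_def adjoint_op_def incl0_def)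
  assume "x \<in> hom g i" "x \<noteq> 0"
  then have t: "tagged g [(i, x)]" by (simp add: tagged_def)
  have h: "hom_ext g F [x] = F [(i, x)]" for F :: "(int \<times> 'g) list \<Rightarrow> 'g"
    using hom_ext_tagged[OF g_fd t, of F] by (simp del: hom_ext.simps)
  have "{0..1::nat} = {0, 1}" by auto
  then show "family_sum (adjoint_op g) y [x] = sgnpow (i - 1) (brk g x y)"
    by (simp add: family_sum_def adjoint_op_def incl0_def h del: hom_ext.simps flip: One_nat_def)
qed

lemma f0_chain_map: "dif g (f0 m) = f0 (mod_diff M m)"
  using commutes_incl0[of m "[]"]
  by (simp add: d_tot_adjoint CE_diff_Nil[OF g_fd] cl_ext_Nil[of _ _ _ "cl_ext g 0 _ _"]
      cl_ext_Nil[of _ _ _ "d_tot g M _"] d_tot_incl0_simps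
      ext_incl0 family_sum_adjoint family_sum_eq[OF family]) (simp add: Pr_def)

text \<open>The morphism equation on \<open>x[1]\<close>, with \<open>f\<^sub>1\<close> as homotopy:
  closedness of \<open>m\<close> removes \<open>f\<^sub>1\<close> of \<open>d\<^sub>0 m\<close>,
  closedness of \<open>x\<close> removes the Chevalley-Eilenberg term, and all remaining terms share
  one sign.\<close>

lemma f0_act:
  assumes x: "x \<in> hom g i" "dif g x = 0" and m: "mod_diff M m = 0"
  obtains y where "f0 (act x m) = brk g x (f0 m) + dif g y"
proof (cases "x = 0")
  case True
  then show ?thesis using that[of 0] by (simp add: act_left.zero f0.zero brk_left.zero g.linear.zero)
next
  case False
  have "sgnpow (i - 1) (f0 (act x m)) = sgnpow (i - 1) (brk g x (f0 m))
      + sgnpow (i - 1) (dif g (f 1 m [x]))"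
    using commutes_incl0[of m "[x]"] x m False
    by (simp add: d_tot_adjoint CE_diff_single[OF g_fd]
      cl_ext_single[OF g_fd, of _ _ _ _ "cl_ext g 0 _ _"]
      cl_ext_single[OF g_fd, of _ _ _ _ "d_tot g M _"] d_tot_incl0_simps contract_zero[OF g_fd]
      ext_incl0 family_sum_adjoint family_sum_eq[OF family] family_zero[OF family]
      family_sgnpow[OF family])
      (simp add: Pr_def)
  then have "f0 (act x m) = brk g x (f0 m) + dif g (f 1 m [x])"
    by (simp only: sgnpow_add[symmetric] sgnpow_inject)
  then show ?thesis by (rule that)
qed

lemma tan_map_cls: "tan_map g f (cls (mod_diff M) m) = cls (dif g) (f0 m)"
  unfolding tan_map_def
  by (rule lift_cls1_eqI) (simp add: f0.add f0_chain_map[symmetric] g.cls_add)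

lemma f0_closed: "mod_diff M m = 0 \<Longrightarrow> dif g (f0 m) = 0"
  by (simp add: f0_chain_map f0.zero)

lemma Loday_Pirashvili_module_tangent:
  "Loday_Pirashvili_module (H_tan_Lie g) (tan_bracket g) (H_tan_mod M) (tan_action g M) (tan_map g f)"
  unfolding Loday_Pirashvili_module_def
proof (intro conjI graded_Lie_algebra_tangent graded_Lie_module_tangent allI ballI)
  show "graded_linear (H_tan_mod M) (H_tan_Lie g) (tan_map g f)"
    unfolding graded_linear_def H_tan_Lie_def H_tan_mod_def
    by (intro allI conjI ballI; elim M.gcomp_cohomologyE)
      (simp_all add: tan_map_cls M.cohomology_ops g.cohomology_ops f0.add f0.scale
        g.gcomp_cohomologyI f0_degree f0_closed)
next
  fix i j X U assume "X \<in> gcomp (H_tan_Lie g) i" "U \<in> gcomp (H_tan_mod M) j"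
  then obtain x m where x: "x \<in> hom g i" "dif g x = 0" and X: "X = cls (dif g) x"
    and m: "m \<in> hom M j" "mod_diff M m = 0" and U: "U = cls (mod_diff M) m"
    unfolding H_tan_Lie_def H_tan_mod_def by (elim g.gcomp_cohomologyE M.gcomp_cohomologyE) blast
  obtain y where y: "f0 (act x m) = brk g x (f0 m) + dif g y"
    using f0_act[OF x m(2)] .
  show "tan_map g f (tan_action g M X U) = tan_bracket g X (tan_map g f U)"
    using x m by (simp add: X U tan_action_cls tan_bracket_cls tan_map_cls f0_closed y g.cls_add)
qed

section \<open>The binary bracket and the Leibniz product\<close>

lemma lambda2_Nil:
  assumes "u \<in> hom M i"
  shows "Pr (lambda2 g M f (incl0 u) (incl0 v)) = sgnpow (i - 1) (act (f0 u) v)"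
proof -
  \<comment> \<open>The contraction fills exactly one slot, and on one argument the sum over
    positive \<open>k\<close> is \<open>d\<^sub>1 v\<close>.\<close>
  have "contract g x (family_sum1 (mop M) v) [] = act x v" for x
    unfolding Pr_def
    by (rule contract_cong[OF g_fd]) (simp add: family_sum1_def flip: One_nat_def)
  then have gen: "lambda2_gen g M f i u v [] = sgnpow (i - 1) (act (f0 u) v)"
    by (simp add: lambda2_gen_def contract_by_def cl_ext_Nil family_sum_eq[OF family] Pr_def)
  \<comment> \<open>\<open>lambda2\<close> reads the degree of its first entry off the homogeneous
    components. For \<open>u = 0\<close> there are none, and both sides vanish.\<close>
  moreover have "{j. component M j u \<noteq> 0} = (if u = 0 then {} else {i})"
    using component_homogeneous[OF M_fd assms] by auto
  moreover have "Pr (lambda2 g M f (incl0 u) (incl0 v)) =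
      (\<Sum>j | component M j u \<noteq> 0. lambda2_gen g M f j (component M j u) v [])"
    by (simp add: Pr_def lambda2_def cl_ext_Nil incl0_def)
  ultimately show ?thesis
    using gen component_homogeneous[OF M_fd assms, of i]
    by (simp add: f0.zero act_left.zero)
qed

text \<open>Both sides are the class of \<open>f0 u\<close> acting on \<open>v\<close>: the sign in
  front cancels the one in \<open>lambda2_Nil\<close>.\<close>

lemma LP_Leibniz_lambda2:
  assumes u: "u \<in> hom M i" "mod_diff M u = 0" and v: "mod_diff M v = 0"
  shows "LP_Leibniz (tan_action g M) (tan_map g f) (cls (mod_diff M) u) (cls (mod_diff M) v) =
    gsmult (H_tan_mod M) ((-1) powi (i - 1))
      (cls (mod_diff M) (Pr (lambda2 g M f (incl0 u) (incl0 v))))"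
  using u v
  by (simp add: LP_Leibniz_def tan_map_cls tan_action_cls[OF f0_degree] f0_closed lambda2_Nil
      H_tan_mod_def M.cohomology_ops scl_powi[OF M_vs])

end

theorem proposition4p6:
  fixes g :: "('k::real_normed_field, 'g::ab_group_add) dgla"
    and M :: "('k, 'g, 'm::ab_group_add) inf_mod"
    and f :: "nat \<Rightarrow> 'm \<Rightarrow> 'g list \<Rightarrow> 'g"
  assumes "dg_Lie_algebra g"
    and "weak_Loday_Pirashvili_module g M f"
  shows "Loday_Pirashvili_module (H_tan_Lie g) (tan_bracket g)
           (H_tan_mod M) (tan_action g M) (tan_map g f) \<and>
         (\<forall>i j. \<forall>u\<in>hom M i. \<forall>v\<in>hom M j. mod_diff M u = 0 \<longrightarrow> mod_diff M v = 0 \<longrightarrow>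
           LP_Leibniz (tan_action g M) (tan_map g f) (cls (mod_diff M) u) (cls (mod_diff M) v) =
           gsmult (H_tan_mod M) ((-1) powi (i - 1))
             (cls (mod_diff M) (Pr (lambda2 g M f (incl0 u) (incl0 v)))))"
proof -
  interpret dgla_module_morphism g M f
    using assms by unfold_locales (simp_all add: weak_Loday_Pirashvili_module_def)
  show ?thesis
    using Loday_Pirashvili_module_tangent LP_Leibniz_lambda2 by blast
qed

end
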